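(* Let $\alpha\models n$ have at most one odd part, set $r=\ell(\alpha)$, let $1\le p<r$, and put $c=c_p$. Let $I$ be a finite set with $|I|=n$. For every $I=S\sqcup T$ with $|S|=c$ and every $\theta\in\mathcal D_n$, the following hold. (i) If $c\notin F_\alpha(\theta)$, then $\Delta^p_{S,T}\bigl(C_\bullet^{t,q}(\alpha;\theta)[I]\bigr)=0$. (ii) If $c\in F_\alpha(\theta)$, write the unique factorization as $\theta=\theta_L\diamond\theta_R$, with $\theta_L\in\mathcal D_c$ and $\theta_R\in\mathcal D_{n-c}$. Then $$\Delta^p_{S,T}\bigl(C_\bullet^{t,q}(\alpha;\theta)[I]\bigr)\subseteq C_\bullet^{t,q}(\alpha_{\le p};\theta_L)[S]\otimes C_\bullet^{t,q}(\alpha_{>p};\theta_R)[T].$$ Moreover, $$F_\alpha(\theta)=F_{\alpha_{\le p}}(\theta_L)\sqcup\{c\}\sqcup\bigl(c+F_{\alpha_{>p}}(\theta_R)\bigr),$$ $$\gamma_\alpha(\theta)=\gamma_{\alpha_{\le p}}(\theta_L)\cdot\gamma_{\alpha_{>p}}(\theta_R),$$ where $c+U=\{c+u:u\in U\}$ and $\cdot$ denotes concatenation of compositions. For each $c_p\in F_\alpha(\theta)$, denote the corresponding factors by $\theta_L^{(p)}$ and $\theta_R^{(p)}$. Then $$\overline\Delta_{\alpha,I}\bigl(C_\bullet^{t,q}(\alpha;\theta)[I]\bigr)\subseteq\bigoplus_{\substack{1\le p<\ell(\alpha)\\ c_p\in F_\alpha(\theta)}}\ \bigoplus_{\substack{I=S\sqcup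 T\\ |S|=c_p}}C_\bullet^{t,q}(\alpha_{\le p};\theta_L^{(p)})[S]\otimes C_\bullet^{t,q}(\alpha_{>p};\theta_R^{(p)})[T].$$ Thus the reduced coproduct respects the total-decoration decomposition, with the decoration index split by unique factorization.
   Context: Conventions. $[m]=\{1,\dots,m\}$, $[0]=\varnothing$; $\mathbb K$ is a field of characteristic zero and all vector spaces are over $\mathbb K$. For $m\ge0$, $m^+=\lceil m/2\rceil$ and $m^-=\lfloor m/2\rfloor$. A composition $\alpha=(\alpha_1,\dots,\alpha_r)\models n$ is a sequence of positive integers with sum $n$; $\ell(\alpha)=r$; its cut set is $D(\alpha)=\{\alpha_1,\alpha_1+\alpha_2,\dots,\alpha_1+\cdots+\alpha_{r-1}\}\subseteq[n-1]$. For $\beta,\alpha\models n$, $\beta\succeq\alpha$ means $D(\beta)\subseteq D(\alpha)$. For $S\subseteq[n-1]$, $\gamma_S$ is the composition of $n$ with $D(\gamma_S)=S$. Decorations. $c(\cdot)$ is the number of cycles of a permutation, fixed points included. For $\sigma\in\mathfrak S_a$, $\sigma'\in\mathfrak S_b$, $\sigma\oplus\sigma'\in\mathfrak S_{a+b}$ acts as $\sigma$ on $[a]$ and by $a+j\mapsto a+\sigma'(j)$ on the rest. $\mathfrak R_s$ is the set of permutations of $\{\ast,1,\dots,s\}$; the cycle containing $\ast$ is the root cycle, written starting at $\ast$. For $\tau\in\mathfrak R_a$, $\upsilon\in\mathfrak R_b$ with root cycles $(\ast,a_1,\dots,a_u)$ and $(\ast,b_1,\dots,b_v)$, $\tau\star\upsilon\in\mathfrak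 R_{a+b}$ has root cycle $(\ast,a_1,\dots,a_u,a+b_1,\dots,a+b_v)$, and its nonroot cycles are those of $\tau$ together with those of $\upsilon$ with every letter shifted by $a$. For $m\ge1$, $\mathcal D_m=\mathfrak S_{m^+}\times\mathfrak R_{m^-}$; for $\xi=(\sigma,\tau)\in\mathcal D_m$, $\deg_q\xi=m^+-c(\sigma)$ and $\deg_t\xi=c(\sigma)+c(\tau)-1$. If $a,b$ are not both odd, $(\sigma,\tau)\diamond(\sigma',\tau')=(\sigma\oplus\sigma',\tau\star\tau')$ defines $\diamond:\mathcal D_a\times\mathcal D_b\to\mathcal D_{a+b}$ (associative, bidegree-additive). Decorated complex. Let $I$ be a finite set, $|I|=n\ge1$, $\alpha\models n$. For $\beta=(\beta_1,\dots,\beta_k)\models n$, $\operatorname{OSP}_\beta[I]$ is the set of ordered set partitions $(B_1,\dots,B_k)$ of $I$ with $|B_i|=\beta_i$. $C_k^{t,q}(\alpha)[I]$ has basis the elements $(B_1,\dots,B_k;\xi_1,\dots,\xi_k)$ with $\beta\succeq\alpha$, $\ell(\beta)=k$, $(B_1,\dots,B_k)\in\operatorname{OSP}_\beta[I]$, $\xi_i\in\mathcal D_{\beta_i}$, bigraded by the sums of the $\deg_t\xi_i$ and of the $\deg_q\xi_i$. The differential is $\sum_{i=1}^{k-1}(-1)^{i-1}d_i^{t,q}$, where $d_i^{t,q}$ merges $B_i,B_{i+1}$ into $B_i\sqcup B_{i+1}$ and replaces $\xi_i,\xi_{i+1}$ by $\xi_i\diamond\xi_{i+1}$ if $\beta_i,\beta_{i+1}$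 are not both odd, and is $0$ if both are odd. When $\alpha$ has at most one odd part, the total decoration of a basis element is $\xi_1\diamond\cdots\diamond\xi_k\in\mathcal D_n$, and for $\theta\in\mathcal D_n$, $C_\bullet^{t,q}(\alpha;\theta)[I]$ is the subcomplex spanned by basis elements with total decoration $\theta$. Factorization cuts. Let $\alpha\models n$ have at most one odd part and $\theta=(\sigma,\tau)\in\mathcal D_n$. A cut $c\in D(\alpha)$ is a factorization cut of $\theta$ if (a) $\sigma([c^+])=[c^+]$; and (b) every nonroot cycle of $\tau$ lies entirely in $[c^-]$ or entirely in $\{c^-+1,\dots,n^-\}$, and in the root cycle $(\ast,a_1,\dots,a_u)$ all letters $\le c^-$ come before all letters $>c^-$. Equivalently, there exist unique $\theta_L\in\mathcal D_c$, $\theta_R\in\mathcal D_{n-c}$ with $\theta=\theta_L\diamond\theta_R$. $F_\alpha(\theta)$ is the set of factorization cuts $c\in D(\alpha)$ of $\theta$, and $\gamma_\alpha(\theta)=\gamma_{F_\alpha(\theta)}$. Cut coproduct. For $\alpha=(\alpha_1,\dots,\alpha_r)$ and $0\le p\le r$, $c_p=\alpha_1+\cdots+\alpha_p$, $\alpha_{\le p}=(\alpha_1,\dots,\alpha_p)$, $\alpha_{>p}=(\alpha_{p+1},\dots,\alpha_r)$. For $I=S\sqcup T$ with $|S|=c_p$ and a basis element $w=(B_1,\dots,B_k;\xi_1,\dots,\xi_k)$ of $C_k^{t,q}(\alpha)[I]$, $$\Delta^p_{S,T}(w)=(B_1,\dots,B_j;\xi_1,\dots,\xi_j)\otimes(B_{j+1},\dots,B_k;\xi_{j+1},\dots,\xi_k)$$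 if $S=B_1\sqcup\cdots\sqcup B_j$ for some $j$, and $\Delta^p_{S,T}(w)=0$ otherwise; this takes values in $C_\bullet^{t,q}(\alpha_{\le p})[S]\otimes C_\bullet^{t,q}(\alpha_{>p})[T]$. The reduced cut coproduct of $\alpha$ is $\overline\Delta_{\alpha,I}=\bigoplus_{p=1}^{r-1}\bigoplus_{I=S\sqcup T,\ |S|=c_p}\Delta^p_{S,T}$ (zero map to zero when $r=1$). *)

theory Defs
  imports Complex_Main "HOL-Library.Poly_Mapping" "HOL-Library.Disjoint_Sets"
    "HOL-Combinatorics.Cycles" "HOL-Combinatorics.Orbits"
begin

section \<open>Free vector spaces\<close>

text \<open>The free vector space over a field \<open>'k\<close> with basis the elements of type \<open>'b\<close> is
  \<open>'b \<Rightarrow>\<^sub>0 'k\<close>; the basis vector of \<open>b\<close> is \<open>Poly_Mapping.single b 1\<close>.\<close>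

definition scale :: "'k::field \<Rightarrow> ('b \<Rightarrow>\<^sub>0 'k) \<Rightarrow> ('b \<Rightarrow>\<^sub>0 'k)" where
  "scale c f = Poly_Mapping.map ((*) c) f"

lemma lookup_scale [simp]: "Poly_Mapping.lookup (scale c f) b = c * Poly_Mapping.lookup f b"
  by (simp add: scale_def Poly_Mapping.map.rep_eq when_def)

interpretation free_vs: vector_space scale
  by unfold_locales (auto intro!: poly_mapping_eqI simp: lookup_add algebra_simps)

definition basis_span :: "'b set \<Rightarrow> ('b \<Rightarrow>\<^sub>0 'k::field) set" where
  "basis_span X = free_vs.span ((\<lambda>b. Poly_Mapping.single b 1) ` X)"

definition linear_extension ::
    "('b \<Rightarrow> ('c \<Rightarrow>\<^sub>0 'k::field)) \<Rightarrow> ('b \<Rightarrow>\<^sub>0 'k) \<Rightarrow> ('c \<Rightarrow>\<^sub>0 'k)" where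
  "linear_extension g f = (\<Sum>b\<in>Poly_Mapping.keys f. scale (Poly_Mapping.lookup f b) (g b))"

text \<open>The tensor product of the free spaces on \<open>'b\<close> and \<open>'c\<close> is the free space on \<open>'b \<times> 'c\<close>,
  the basis vector of \<open>(b, c)\<close> being the tensor of the basis vectors of \<open>b\<close> and \<open>c\<close>.\<close>

definition tensor :: "('b \<Rightarrow>\<^sub>0 'k::field) \<Rightarrow> ('c \<Rightarrow>\<^sub>0 'k) \<Rightarrow> ('b \<times> 'c \<Rightarrow>\<^sub>0 'k)" where
  "tensor u v = (\<Sum>b\<in>Poly_Mapping.keys u. \<Sum>c\<in>Poly_Mapping.keys v.
     Poly_Mapping.single (b, c) (Poly_Mapping.lookup u b * Poly_Mapping.lookup v c))"

definition tensor_space ::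
    "('b \<Rightarrow>\<^sub>0 'k::field) set \<Rightarrow> ('c \<Rightarrow>\<^sub>0 'k) set \<Rightarrow> ('b \<times> 'c \<Rightarrow>\<^sub>0 'k) set" where
  "tensor_space U V = free_vs.span {tensor u v | u v. u \<in> U \<and> v \<in> V}"

definition direct_sum :: "'j set \<Rightarrow> ('j \<Rightarrow> 'v::zero set) \<Rightarrow> ('j \<Rightarrow> 'v) set" where
  "direct_sum J V = {g. (\<forall>j\<in>J. g j \<in> V j) \<and> (\<forall>j. j \<notin> J \<longrightarrow> g j = 0) \<and> finite {j. g j \<noteq> 0}}"


section \<open>Compositions\<close>

definition composition :: "nat list \<Rightarrow> nat \<Rightarrow> bool" where
  "composition \<alpha> n \<longleftrightarrow> (\<forall>a\<in>set \<alpha>. 0 < a) \<and> sum_list \<alpha> = n"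

text \<open>\<open>psum \<alpha> p\<close> is \<open>c\<^sub>p = \<alpha>\<^sub>1 + \<dots> + \<alpha>\<^sub>p\<close>; the compositions \<open>\<alpha>\<^sub>\<le>\<^sub>p\<close> and \<open>\<alpha>\<^sub>>\<^sub>p\<close> are
  \<open>take p \<alpha>\<close> and \<open>drop p \<alpha>\<close>.\<close>

definition psum :: "nat list \<Rightarrow> nat \<Rightarrow> nat" where
  "psum \<alpha> p = sum_list (take p \<alpha>)"

definition cut_set :: "nat list \<Rightarrow> nat set" where
  "cut_set \<alpha> = {psum \<alpha> p | p. 1 \<le> p \<and> p < length \<alpha>}"

definition coarsens :: "nat list \<Rightarrow> nat list \<Rightarrow> bool" where
  "coarsens \<beta> \<alpha> \<longleftrightarrow> cut_set \<beta> \<subseteq> cut_set \<alpha>"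

definition composition_of_cuts :: "nat \<Rightarrow> nat set \<Rightarrow> nat list" where
  "composition_of_cuts n S = (THE \<gamma>. composition \<gamma> n \<and> cut_set \<gamma> = S)"

definition at_most_one_odd :: "nat list \<Rightarrow> bool" where
  "at_most_one_odd \<alpha> \<longleftrightarrow> length (filter odd \<alpha>) \<le> 1"


section \<open>Decorations\<close>

definition upper_half :: "nat \<Rightarrow> nat" where "upper_half m = (m + 1) div 2"
definition lower_half :: "nat \<Rightarrow> nat" where "lower_half m = m div 2"

text \<open>Permutations of \<open>[a]\<close> are functions with \<open>\<sigma> permutes {1..a}\<close>, the identity elsewhere.
  The letter \<open>\<ast>\<close> is encoded as \<open>0\<close>, so elements of \<open>\<RR>\<^sub>s\<close> are functions with
  \<open>\<tau> permutes {0..s}\<close>.\<close>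

type_synonym decoration = "(nat \<Rightarrow> nat) \<times> (nat \<Rightarrow> nat)"

definition decorations :: "nat \<Rightarrow> decoration set" where
  "decorations m = {\<sigma>. \<sigma> permutes {1..upper_half m}} \<times> {\<tau>. \<tau> permutes {0..lower_half m}}"

definition num_cycles :: "(nat \<Rightarrow> nat) \<Rightarrow> nat set \<Rightarrow> nat" where
  "num_cycles \<pi> A = card (orbit \<pi> ` A)"

definition deg_q :: "nat \<Rightarrow> decoration \<Rightarrow> nat" where
  "deg_q m \<xi> = upper_half m - num_cycles (fst \<xi>) {1..upper_half m}"

definition deg_t :: "nat \<Rightarrow> decoration \<Rightarrow> nat" where
  "deg_t m \<xi> = num_cycles (fst \<xi>) {1..upper_half m} + num_cycles (snd \<xi>) {0..lower_half m} - 1"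

text \<open>The letters \<open>a\<^sub>1, \<dots>, a\<^sub>u\<close> of the root cycle \<open>(\<ast>, a\<^sub>1, \<dots>, a\<^sub>u)\<close>;
  \<open>support \<tau> x\<close> lists the cycle of \<open>\<tau>\<close> through \<open>x\<close>, starting at \<open>x\<close>.\<close>

definition root_letters :: "(nat \<Rightarrow> nat) \<Rightarrow> nat list" where
  "root_letters \<tau> = tl (support \<tau> 0)"

text \<open>In the next three operations \<open>a\<close> is the size index of the left factor.\<close>

definition perm_oplus :: "nat \<Rightarrow> (nat \<Rightarrow> nat) \<Rightarrow> (nat \<Rightarrow> nat) \<Rightarrow> (nat \<Rightarrow> nat)" where
  "perm_oplus a \<sigma> \<sigma>' = (\<lambda>x. if x \<le> a then \<sigma> x else a + \<sigma>' (x - a))"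

definition root_star :: "nat \<Rightarrow> (nat \<Rightarrow> nat) \<Rightarrow> (nat \<Rightarrow> nat) \<Rightarrow> (nat \<Rightarrow> nat)" where
  "root_star a \<tau> \<upsilon> =
     (let rc = 0 # root_letters \<tau> @ map ((+) a) (root_letters \<upsilon>) in
      (\<lambda>x. if x \<in> set rc then cycle_of_list rc x
           else if x \<le> a then \<tau> x
           else a + \<upsilon> (x - a)))"

definition diamond :: "nat \<Rightarrow> decoration \<Rightarrow> decoration \<Rightarrow> decoration" where
  "diamond a \<xi> \<xi>' = (perm_oplus (upper_half a) (fst \<xi>) (fst \<xi>'),
                    root_star (lower_half a) (snd \<xi>) (snd \<xi>'))"

text \<open>\<open>\<xi>\<^sub>1 \<diamond> \<dots> \<diamond> \<xi>\<^sub>k\<close>, each \<open>\<xi>\<^sub>i\<close> being given together with its size \<open>\<beta>\<^sub>i\<close>. The value for the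
  empty list is the unit of \<open>\<diamond>\<close>.\<close>

fun diamond_list :: "(nat \<times> decoration) list \<Rightarrow> decoration" where
  "diamond_list [] = (id, id)"
| "diamond_list [(b, \<xi>)] = \<xi>"
| "diamond_list ((b, \<xi>) # w # ws) = diamond b \<xi> (diamond_list (w # ws))"


section \<open>The decorated complex\<close>

definition ordered_set_partitions :: "nat list \<Rightarrow> 'a set \<Rightarrow> 'a set list set" where
  "ordered_set_partitions \<beta> I =
     {Bs. map card Bs = \<beta> \<and> \<Union>(set Bs) = I \<and> disjoint_family_on ((!) Bs) {..<length Bs}}"

type_synonym 'a cell = "'a set list \<times> decoration list"

definition cells :: "nat list \<Rightarrow> 'a set \<Rightarrow> nat \<Rightarrow> 'a cell set" where
  "cells \<alpha> I k = {(Bs, \<xi>s). \<exists>\<beta>. composition \<beta> (sum_list \<alpha>) \<and> coarsens \<beta> \<alpha> \<and> length \<beta> = k \<and>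
     Bs \<in> ordered_set_partitions \<beta> I \<and> length \<xi>s = k \<and> (\<forall>i<k. \<xi>s ! i \<in> decorations (\<beta> ! i))}"

definition cell_deg_t :: "'a cell \<Rightarrow> nat" where
  "cell_deg_t w = (\<Sum>(B, \<xi>)\<leftarrow>zip (fst w) (snd w). deg_t (card B) \<xi>)"

definition cell_deg_q :: "'a cell \<Rightarrow> nat" where
  "cell_deg_q w = (\<Sum>(B, \<xi>)\<leftarrow>zip (fst w) (snd w). deg_q (card B) \<xi>)"

definition total_decoration :: "'a cell \<Rightarrow> decoration" where
  "total_decoration w = diamond_list (zip (map card (fst w)) (snd w))"

definition chains :: "nat list \<Rightarrow> 'a set \<Rightarrow> ('a cell \<Rightarrow>\<^sub>0 'k::field_char_0) set" where
  "chains \<alpha> I = basis_span (\<Union>k. cells \<alpha> I k)"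

definition chains_dec ::
    "nat list \<Rightarrow> decoration \<Rightarrow> 'a set \<Rightarrow> ('a cell \<Rightarrow>\<^sub>0 'k::field_char_0) set" where
  "chains_dec \<alpha> \<theta> I = basis_span {w \<in> (\<Union>k. cells \<alpha> I k). total_decoration w = \<theta>}"

text \<open>List positions are counted from \<open>0\<close>: \<open>face i\<close> is \<open>d\<^sub>i\<^sub>+\<^sub>1\<close> and carries the sign \<open>(-1)\<^sup>i\<close>.\<close>

definition face :: "nat \<Rightarrow> 'a cell \<Rightarrow> ('a cell \<Rightarrow>\<^sub>0 'k::field_char_0)" where
  "face i w = (let Bs = fst w; \<xi>s = snd w in
     if odd (card (Bs ! i)) \<and> odd (card (Bs ! Suc i)) then 0
     else Poly_Mapping.single
       (take i Bs @ [Bs ! i \<union> Bs ! Suc i] @ drop (i + 2) Bs,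
        take i \<xi>s @ [diamond (card (Bs ! i)) (\<xi>s ! i) (\<xi>s ! Suc i)] @ drop (i + 2) \<xi>s) 1)"

definition differential :: "('a cell \<Rightarrow>\<^sub>0 'k::field_char_0) \<Rightarrow> ('a cell \<Rightarrow>\<^sub>0 'k)" where
  "differential = linear_extension (\<lambda>w. \<Sum>i<length (fst w) - 1. scale ((-1) ^ i) (face i w))"


section \<open>Factorization cuts\<close>

definition factorization_cut :: "nat \<Rightarrow> decoration \<Rightarrow> nat \<Rightarrow> bool" where
  "factorization_cut n \<theta> c \<longleftrightarrow>
     (let \<sigma> = fst \<theta>; \<tau> = snd \<theta>; as = root_letters \<tau> in
      \<sigma> ` {1..upper_half c} = {1..upper_half c} \<and>
      (\<forall>x \<in> {1..lower_half n} - set as.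
         orbit \<tau> x \<subseteq> {1..lower_half c} \<or> orbit \<tau> x \<subseteq> {lower_half c + 1..lower_half n}) \<and>
      (\<forall>i<length as. \<forall>j<length as. as ! i \<le> lower_half c \<and> lower_half c < as ! j \<longrightarrow> i < j))"

definition factorization_cuts :: "nat list \<Rightarrow> decoration \<Rightarrow> nat set" where
  "factorization_cuts \<alpha> \<theta> = {c \<in> cut_set \<alpha>. factorization_cut (sum_list \<alpha>) \<theta> c}"

definition cut_composition :: "nat list \<Rightarrow> decoration \<Rightarrow> nat list" where
  "cut_composition \<alpha> \<theta> = composition_of_cuts (sum_list \<alpha>) (factorization_cuts \<alpha> \<theta>)"

definition is_factorization :: "nat \<Rightarrow> nat \<Rightarrow> decoration \<Rightarrow> decoration \<times> decoration \<Rightarrow> bool" where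
  "is_factorization n c \<theta> \<theta>s \<longleftrightarrow>
     \<theta>s \<in> decorations c \<times> decorations (n - c) \<and> \<theta> = diamond c (fst \<theta>s) (snd \<theta>s)"

definition left_factor :: "nat \<Rightarrow> nat \<Rightarrow> decoration \<Rightarrow> decoration" where
  "left_factor n c \<theta> = fst (THE \<theta>s. is_factorization n c \<theta> \<theta>s)"

definition right_factor :: "nat \<Rightarrow> nat \<Rightarrow> decoration \<Rightarrow> decoration" where
  "right_factor n c \<theta> = snd (THE \<theta>s. is_factorization n c \<theta> \<theta>s)"


section \<open>The cut coproduct\<close>

text \<open>The formula for \<open>\<Delta>\<^sup>p\<^sub>S\<^sub>,\<^sub>T\<close> involves \<open>S\<close> only: \<open>T\<close> is the complement of \<open>S\<close>, and \<open>p\<close> is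
  determined by \<open>|S| = c\<^sub>p\<close>.\<close>

definition cut_cell :: "'a set \<Rightarrow> 'a cell \<Rightarrow> ('a cell \<times> 'a cell \<Rightarrow>\<^sub>0 'k::field_char_0)" where
  "cut_cell S w = (let Bs = fst w; \<xi>s = snd w in
     if \<exists>j\<le>length Bs. S = \<Union>(set (take j Bs)) then
       (let j = (THE j. j \<le> length Bs \<and> S = \<Union>(set (take j Bs))) in
        tensor (Poly_Mapping.single (take j Bs, take j \<xi>s) 1)
               (Poly_Mapping.single (drop j Bs, drop j \<xi>s) 1))
     else 0)"

definition cut_coproduct ::
    "'a set \<Rightarrow> ('a cell \<Rightarrow>\<^sub>0 'k::field_char_0) \<Rightarrow> ('a cell \<times> 'a cell \<Rightarrow>\<^sub>0 'k)" where
  "cut_coproduct S = linear_extension (cut_cell S)"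

definition splits :: "nat list \<Rightarrow> 'a set \<Rightarrow> (nat \<times> 'a set \<times> 'a set) set" where
  "splits \<alpha> I = {(p, S, T). 1 \<le> p \<and> p < length \<alpha> \<and> S \<union> T = I \<and> S \<inter> T = {} \<and> card S = psum \<alpha> p}"

definition reduced_cut_coproduct ::
    "nat list \<Rightarrow> 'a set \<Rightarrow> ('a cell \<Rightarrow>\<^sub>0 'k::field_char_0) \<Rightarrow>
     (nat \<times> 'a set \<times> 'a set \<Rightarrow> ('a cell \<times> 'a cell \<Rightarrow>\<^sub>0 'k))" where
  "reduced_cut_coproduct \<alpha> I f =
     (\<lambda>(p, S, T). if (p, S, T) \<in> splits \<alpha> I then cut_coproduct S f else 0)"

end

theory Submission
  imports Defs
begin

text \<open>The whole statement rests on a local description of the product \<open>\<star>\<close> on permutations with a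
  root. The permutation \<open>\<tau>\<star>\<upsilon>\<close> acts as \<open>\<tau>\<close> on the low letters and as the shifted \<open>\<upsilon>\<close> on the
  high letters, except that an arrow of \<open>\<tau>\<close> into the root is redirected to the image of the root under
  the shifted \<open>\<upsilon>\<close> (lemma \<open>root_star_apply\<close>). In other words, \<open>\<tau>\<star>\<upsilon>\<close> is the composite of \<open>\<tau>\<close>
  followed by \<open>\<upsilon>\<close> transported to the root and the high letters. With this formula, cycles no
  longer have to be written out: associativity and injectivity of \<open>\<diamond>\<close> are checked pointwise.

  The cycle condition that defines a factorization cut is local too. A permutation can be cut after
  the letter \<open>m\<close> exactly if no letter above \<open>m\<close> is mapped to one of \<open>1, \<dots>, m\<close>, because a
  cycle that has climbed above \<open>m\<close> can then come down only through the root
  (\<open>root_factorization_iff\<close>). Under this condition the high letters determine \<open>\<upsilon>\<close> up to its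
  value at the root, which is forced by bijectivity, and \<open>\<tau>\<close> is what remains
  (\<open>root_star_exists\<close>); this gives unique factorization. The condition can also be compared between
  \<open>\<theta>\<^sub>L \<diamond> \<theta>\<^sub>R\<close> and its factors: at or below the cut only \<open>\<theta>\<^sub>L\<close> matters, at or above it only
  \<open>\<theta>\<^sub>R\<close> (\<open>factorization_cut_diamond\<close>), which yields the decomposition of the set of factorization
  cuts. The equality of compositions follows, since a composition is determined by its cut set.

  The hypothesis on odd parts enters through the halves \<open>m\<^sup>+\<close> and \<open>m\<^sup>-\<close>, which are additive only
  when the summands are not both odd. In terms of cut sets it says that along the cuts, followed by
  \<open>n\<close>, an odd value is never followed by an even one (\<open>at_most_one_odd_iff\<close>). Hence it passes to
  coarser compositions, and every product that occurs below is associative and has the right size.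

  Finally, let a cell be cut at a union \<open>S\<close> of initial blocks, \<open>|S| = c\<^sub>p\<close>. By associativity its total
  decoration is the product of the total decorations of the two pieces (\<open>cut_cell_pieces\<close>). So a
  cell of total decoration \<open>\<theta>\<close> can only contribute if \<open>c\<^sub>p\<close> is a factorization cut of \<open>\<theta>\<close>, and then
  uniqueness of the factorization identifies the decorations of the pieces as \<open>\<theta>\<^sub>L\<close> and \<open>\<theta>\<^sub>R\<close>. Linear
  extension finishes the argument.\<close>

section \<open>Root cycles and their concatenation\<close>

lemma permutes_injD: "p permutes S \<Longrightarrow> p x = p y \<Longrightarrow> x = y"
  using permutes_inj by (metis injD)

lemma map_support:
  assumes "permutation p"
  shows "map p (support p x) = rotate1 (support p x)"
proof (rule nth_equalityI)
  fix i assume "i < length (map p (support p x))"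
  hence i: "i < least_power p x" by simp
  show "map p (support p x) ! i = rotate1 (support p x) ! i"
  proof (cases "Suc i = least_power p x")
    case True
    have "p ((p ^^ i) x) = x"
      using least_power_of_permutation(1)[OF assms, of x, folded True] by simp
    then show ?thesis using i True by (simp add: nth_rotate1)
  next
    case False
    then show ?thesis using i by (simp add: nth_rotate1)
  qed
qed simp

lemma finite_permutes_permutation:
  assumes "\<tau> permutes {0..a::nat}"
  shows "permutation \<tau>"
  using assms permutation_permutes by blast

lemma root_cycle:
  assumes "\<tau> permutes {0..a}"
  shows "support \<tau> 0 = 0 # root_letters \<tau>"
    and "map \<tau> (0 # root_letters \<tau>) = root_letters \<tau> @ [0]"
    and "distinct (0 # root_letters \<tau>)"
    and "set (0 # root_letters \<tau>) = orbit \<tau> 0"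
proof -
  have perm: "permutation \<tau>" using finite_permutes_permutation[OF assms] .
  have pos: "0 < least_power \<tau> 0" using least_power_of_permutation(2)[OF perm] .
  then show eq: "support \<tau> 0 = 0 # root_letters \<tau>"
    by (simp add: root_letters_def upt_conv_Cons)
  show "map \<tau> (0 # root_letters \<tau>) = root_letters \<tau> @ [0]"
    using map_support[OF perm, of 0] unfolding eq by simp
  show "distinct (0 # root_letters \<tau>)"
    using cycle_of_permutation[OF perm, of 0] unfolding eq .
  show "set (0 # root_letters \<tau>) = orbit \<tau> 0"
    using support_set[OF perm, of 0] unfolding eq orbit_altdef_permutation[OF perm] by auto
qed

text \<open>The relabelling of the right factor in \<open>\<star>\<close>: the root, encoded as \<open>0\<close>, is shared by both
  factors, all other letters move up by \<open>a\<close>.\<close>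

definition shift_nonroot :: "nat \<Rightarrow> nat \<Rightarrow> nat" where
  "shift_nonroot a y = (if y = 0 then 0 else a + y)"

text \<open>For \<open>x > a\<close> the subtraction recovers the letter of \<open>\<upsilon>\<close>. For \<open>x \<le> a\<close> with
  \<open>\<tau> x = 0\<close> it truncates to \<open>0\<close>, so the arrow of \<open>\<tau>\<close> back to the root continues with the
  image of the root under \<open>\<upsilon>\<close>. On the concatenated root cycle, the function on the right-hand side
  rotates the list of letters by one place, and this characterizes the values of \<open>cycle_of_list\<close>
  there. Off that cycle, neither factor maps a letter to
  the root.\<close>

lemma root_star_apply:
  assumes \<tau>: "\<tau> permutes {0..a}" and \<upsilon>: "\<upsilon> permutes {0..b}"
  shows "root_star a \<tau> \<upsilon> x = (if x \<le> a \<and> \<tau> x \<noteq> 0 then \<tau> x else shift_nonroot a (\<upsilon> (x - a)))"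
proof -
  define \<rho> where "\<rho> x = (if x \<le> a \<and> \<tau> x \<noteq> 0 then \<tau> x else shift_nonroot a (\<upsilon> (x - a)))" for x
  define A where "A = root_letters \<tau>"
  define B where "B = root_letters \<upsilon>"
  define rc where "rc = 0 # A @ map ((+) a) B"
  note rt = root_cycle[OF \<tau>, folded A_def] and ru = root_cycle[OF \<upsilon>, folded B_def]
  have A0: "0 \<notin> set A" and B0: "0 \<notin> set B" using rt(3) ru(3) by auto
  have "orbit \<tau> 0 \<subseteq> {0..a}" using permutes_orbit_subset[OF \<tau>] by simp
  hence Aa: "x \<le> a" if "x \<in> set A" for x using that rt(4) by auto
  have dist: "distinct rc" unfolding rc_def
    using rt(3) ru(3) Aa by (auto simp: distinct_map) (metis B0 Nat.le_diff_conv2 add_diff_cancel_left' bot_nat_0.extremum_uniqueI diff_is_0_eq' le_add1)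
  \<comment> \<open>split off the last letter of the root cycle of \<open>\<tau>\<close>, the only one sent to \<open>0\<close>\<close>
  obtain X l where Xl: "0 # A = X @ [l]" by (metis neq_Nil_conv rev_exhaust)
  have mX: "map \<tau> X = A" and ml: "\<tau> l = 0" using rt(2) unfolding Xl by auto
  have setX: "set X \<union> {l} = insert 0 (set A)" using arg_cong[OF Xl, of set] by auto
  have "map \<rho> X = map \<tau> X"
  proof (rule map_cong[OF refl])
    fix x assume x: "x \<in> set X"
    hence "\<tau> x \<in> set A" using mX by (metis image_eqI set_map)
    moreover have "x \<in> insert 0 (set A)" using x setX by blast
    hence "x \<le> a" using Aa by auto
    ultimately show "\<rho> x = \<tau> x" using A0 unfolding \<rho>_def by auto
  qed
  hence 1: "map \<rho> X = A" using mX by simp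
  have "l \<in> insert 0 (set A)" using setX by blast
  hence "l \<le> a" using Aa by auto
  hence 2: "\<rho> l = shift_nonroot a (\<upsilon> 0)" using ml by (simp add: \<rho>_def)
  have 3: "map \<rho> (map ((+) a) B) = map (shift_nonroot a) (map \<upsilon> B)"
    using B0 by (auto simp: \<rho>_def)
  have "map \<rho> rc = A @ map (shift_nonroot a) (map \<upsilon> (0 # B))"
    unfolding rc_def append_Cons[symmetric] Xl using 1 2 3 by simp
  also have "\<dots> = A @ map (shift_nonroot a) B @ [0]"
    unfolding ru(2) by (simp add: shift_nonroot_def)
  also have "map (shift_nonroot a) B = map ((+) a) B"
    using B0 by (auto simp: shift_nonroot_def)
  also have "A @ map ((+) a) B @ [0] = rotate1 rc" by (simp add: rc_def)
  also have "\<dots> = map (cycle_of_list rc) rc" using cyclic_rotation[OF dist, of 1] by simp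
  finally have on: "\<rho> x = cycle_of_list rc x" if "x \<in> set rc" for x using that by simp
  have off: "\<rho> x = (if x \<le> a then \<tau> x else a + \<upsilon> (x - a))" if x: "x \<notin> set rc" for x
  proof (cases "x \<le> a")
    case True
    have "l \<in> insert 0 (set A)" using setX by blast
    hence "x \<noteq> l" using x unfolding rc_def by auto
    hence "\<tau> x \<noteq> 0" using ml permutes_injD[OF \<tau>, of x l] by auto
    then show ?thesis using True by (simp add: \<rho>_def)
  next
    case False
    hence "x - a \<notin> set (0 # B)" using x unfolding rc_def
      by (metis Un_iff add_diff_inverse_nat diff_is_0_eq image_eqI less_or_eq_imp_le set_ConsD set_append set_map list.set_intros(2) linorder_not_less)
    moreover have "0 \<in> \<upsilon> ` set (0 # B)"
      using arg_cong[OF ru(2), of set] by auto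
    ultimately have "\<upsilon> (x - a) \<noteq> 0"
      using permutes_injD[OF \<upsilon>] by (metis image_iff)
    then show ?thesis using False by (simp add: \<rho>_def shift_nonroot_def)
  qed
  show ?thesis
    using on off unfolding \<rho>_def[symmetric] root_star_def Let_def
      A_def[symmetric] B_def[symmetric] rc_def[symmetric] by auto
qed

section \<open>Factorization cuts as a local condition\<close>

text \<open>Absence of arrows from above \<open>m\<close> to \<open>1, \<dots>, m\<close>. No upper bound on \<open>x\<close> is imposed: a
  letter that is fixed satisfies the condition trivially.\<close>

definition stays_above :: "nat \<Rightarrow> (nat \<Rightarrow> nat) \<Rightarrow> bool" where
  "stays_above m \<tau> \<longleftrightarrow> (\<forall>x>m. \<tau> x = 0 \<or> m < \<tau> x)"

text \<open>A violating arrow \<open>x \<mapsto> \<tau> x\<close> lies on one cycle, and puts letters of both kinds on a nonroot cycle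
  or a high letter directly before a low one on the root cycle. Conversely, if no arrow violates the
  condition, then an orbit which avoids the root and reaches a high letter consists of high letters,
  and the root cycle, once above \<open>m\<close>, stays there until it returns to the root.\<close>

lemma root_factorization_iff:
  assumes \<tau>: "\<tau> permutes {0..N}"
  shows "(\<forall>x \<in> {1..N} - set (root_letters \<tau>).
         orbit \<tau> x \<subseteq> {1..m} \<or> orbit \<tau> x \<subseteq> {m + 1..N}) \<and>
      (\<forall>i<length (root_letters \<tau>). \<forall>j<length (root_letters \<tau>).
         root_letters \<tau> ! i \<le> m \<and> m < root_letters \<tau> ! j \<longrightarrow> i < j) \<longleftrightarrow> stays_above m \<tau>"
    (is "?orb \<and> ?root \<longleftrightarrow> _")
proof -
  have perm: "permutation \<tau>" using finite_permutes_permutation[OF \<tau>] .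
  define A where "A = root_letters \<tau>"
  note r = root_cycle[OF \<tau>, folded A_def]
  have A0: "0 \<notin> set A" using r(3) by simp
  have next_letter: "\<tau> (A ! i) = (if Suc i < length A then A ! Suc i else 0)" if "i < length A" for i
  proof -
    have "\<tau> (A ! i) = map \<tau> (0 # A) ! Suc i" using that by simp
    also have "\<dots> = (A @ [0]) ! Suc i" using r(2) by simp
    finally show ?thesis using that by (auto simp: nth_append)
  qed
  show ?thesis
  proof (intro iffI conjI)
    assume "?orb \<and> ?root"
    hence orb: ?orb and root: ?root by auto
    show "stays_above m \<tau>" unfolding stays_above_def
    proof (intro allI impI)
      fix x assume x: "m < x"
      show "\<tau> x = 0 \<or> m < \<tau> x"
      proof (rule ccontr)
        assume n: "\<not> ?thesis"
        have xN: "x \<le> N" using n x permutes_not_in[OF \<tau>, of x] by fastforce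
        show False
        proof (cases "x \<in> set A")
          case True
          then obtain i where i: "i < length A" "x = A ! i" by (auto simp: in_set_conv_nth)
          hence "Suc i < length A" "\<tau> x = A ! Suc i" using next_letter[of i] n by (auto split: if_splits)
          then show False using root[folded A_def] i x n by (metis Suc_n_not_le_n leI less_imp_le)
        next
          case False
          have "x \<in> orbit \<tau> x" "\<tau> x \<in> orbit \<tau> x"
            using permutation_self_in_orbit[OF perm] by (auto intro: orbit.base)
          then show False using orb False n x xN unfolding A_def by fastforce
        qed
      qed
    qed
  next
    assume E: "stays_above m \<tau>"
    show ?orb
    proof
      fix x assume x: "x \<in> {1..N} - set (root_letters \<tau>)"
      have x0: "0 \<notin> orbit \<tau> x"
      proof
        assume "0 \<in> orbit \<tau> x"
        hence "x \<in> orbit \<tau> 0" using orbit_swap[OF permutation_self_in_orbit[OF perm]] by blast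
        hence "x \<in> set (0 # A)" unfolding r(4) .
        then show False using x by (simp add: A_def)
      qed
      have sub: "orbit \<tau> x \<subseteq> {0..N}" using permutes_orbit_subset[OF \<tau>] x by auto
      show "orbit \<tau> x \<subseteq> {1..m} \<or> orbit \<tau> x \<subseteq> {m + 1..N}"
      proof (cases "\<exists>z\<in>orbit \<tau> x. m < z")
        case True
        then obtain z where z: "z \<in> orbit \<tau> x" "m < z" by blast
        have "cyclic_on \<tau> (orbit \<tau> x)" using cyclic_on_orbit'[OF perm] .
        hence eq: "orbit \<tau> z = orbit \<tau> x" using orbit_cyclic_eq3 z(1) by metis
        have "m < y" if "y \<in> orbit \<tau> z" for y
          using that
        proof induct
          case base
          have "\<tau> z \<noteq> 0" using x0 eq orbit.base by metis
          then show ?case using E z unfolding stays_above_def by auto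
        next
          case (step y)
          hence "\<tau> y \<noteq> 0" using x0 eq orbit.step by metis
          then show ?case using E step unfolding stays_above_def by auto
        qed
        then show ?thesis using eq sub by fastforce
      next
        case False
        then show ?thesis using x0 by (metis atLeastAtMost_iff linorder_not_le not_less_eq_eq One_nat_def le_zero_eq subsetI)
      qed
    qed
    show ?root unfolding A_def[symmetric]
    proof (intro allI impI)
      fix i j assume i: "i < length A" and j: "j < length A" and ij: "A ! i \<le> m \<and> m < A ! j"
      show "i < j"
      proof (rule ccontr)
        assume "\<not> i < j"
        hence "j \<le> i" by simp
        hence "i < length A \<longrightarrow> m < A ! i"
        proof (induct i rule: dec_induct)
          case base
          show ?case using ij by simp
        next
          case (step k)
          show ?case
          proof
            assume k: "Suc k < length A"
            hence "\<tau> (A ! k) = A ! Suc k" "A ! Suc k \<noteq> 0"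
              using A0 next_letter[of k] nth_mem[OF k] by (simp, metis)
            then show "m < A ! Suc k" using step k E unfolding stays_above_def by (metis Suc_lessD)
          qed
        qed
        then show False using i ij by simp
      qed
    qed
  qed
qed

lemma factorization_cut_iff:
  assumes "\<theta> \<in> decorations n"
  shows "factorization_cut n \<theta> c \<longleftrightarrow>
    fst \<theta> ` {1..upper_half c} = {1..upper_half c} \<and> stays_above (lower_half c) (snd \<theta>)"
proof -
  have "snd \<theta> permutes {0..lower_half n}" using assms by (auto simp: decorations_def)
  from root_factorization_iff[OF this, of "lower_half c"] show ?thesis
    unfolding factorization_cut_def Let_def by simp
qed

section \<open>Unique factorization\<close>

lemma permutes_finiteI:
  assumes "finite S" "inj_on f S" "\<And>x. x \<in> S \<Longrightarrow> f x \<in> S" "\<And>x. x \<notin> S \<Longrightarrow> f x = x"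
  shows "f permutes S"
proof (rule bij_imp_permutes)
  show "bij_betw f S S"
    unfolding bij_betw_def using endo_inj_surj[OF assms(1) _ assms(2)] assms(2,3) by blast
qed (use assms in auto)

lemma perm_oplus_permutes:
  assumes \<sigma>: "\<sigma> permutes {1..a}" and \<sigma>': "\<sigma>' permutes {1..b}"
  shows "perm_oplus a \<sigma> \<sigma>' permutes {1..a + b}"
proof (rule permutes_finiteI)
  have le: "\<sigma> x \<le> a \<longleftrightarrow> x \<le> a" for x
    using permutes_in_image[OF \<sigma>, of x] permutes_not_in[OF \<sigma>, of x]
    by (metis One_nat_def Suc_leI atLeastAtMost_iff bot_nat_0.extremum gr_zeroI)
  have b: "\<sigma>' y \<in> {1..b}" if "y \<in> {1..b}" for y using permutes_in_image[OF \<sigma>'] that by blast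
  show "inj_on (perm_oplus a \<sigma> \<sigma>') {1..a + b}"
  proof (rule inj_onI)
    fix x y assume x: "x \<in> {1..a+b}" and y: "y \<in> {1..a+b}"
      and eq: "perm_oplus a \<sigma> \<sigma>' x = perm_oplus a \<sigma> \<sigma>' y"
    have gt: "1 \<le> \<sigma>' (z - a)" if "a < z" "z \<in> {1..a+b}" for z 
    proof -
      have "z - a \<in> {1..b}" using that by auto
      then show ?thesis using b by auto
    qed
    show "x = y"
    proof (cases "x \<le> a"; cases "y \<le> a")
      assume "x \<le> a" "y \<le> a"
      then show ?thesis using eq permutes_injD[OF \<sigma>, of x y] by (simp add: perm_oplus_def)
    next
      assume "x \<le> a" "\<not> y \<le> a"
      then show ?thesis using eq le[of x] gt[of y] y by (auto simp: perm_oplus_def)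
    next
      assume "\<not> x \<le> a" "y \<le> a"
      then show ?thesis using eq le[of y] gt[of x] x by (auto simp: perm_oplus_def)
    next
      assume "\<not> x \<le> a" "\<not> y \<le> a"
      then show ?thesis using eq permutes_injD[OF \<sigma>', of "x - a" "y - a"] by (simp add: perm_oplus_def)
    qed
  qed
  show "perm_oplus a \<sigma> \<sigma>' x \<in> {1..a + b}" if x: "x \<in> {1..a + b}" for x
  proof (cases "x \<le> a")
    case True
    then show ?thesis using x permutes_in_image[OF \<sigma>, of x] by (auto simp: perm_oplus_def)
  next
    case False
    hence "x - a \<in> {1..b}" using x by auto
    then show ?thesis using x False b[of "x - a"] by (auto simp: perm_oplus_def)
  qed
  show "perm_oplus a \<sigma> \<sigma>' x = x" if x: "x \<notin> {1..a + b}" for x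
  proof (cases "x \<le> a")
    case True
    then show ?thesis using x permutes_not_in[OF \<sigma>, of x] by (auto simp: perm_oplus_def)
  next
    case False
    hence "x - a \<notin> {1..b}" using x by auto
    then show ?thesis using False permutes_not_in[OF \<sigma>', of "x - a"] by (simp add: perm_oplus_def)
  qed
qed simp

lemma root_star_permutes:
  assumes \<tau>: "\<tau> permutes {0..a}" and \<upsilon>: "\<upsilon> permutes {0..b}"
  shows "root_star a \<tau> \<upsilon> permutes {0..a + b}"
proof (rule permutes_finiteI)
  note app = root_star_apply[OF \<tau> \<upsilon>]
  have le: "\<tau> x \<le> a" if "x \<le> a" for x using permutes_in_image[OF \<tau>, of x] that by simp
  have le': "\<upsilon> x \<le> b" if "x \<le> b" for x using permutes_in_image[OF \<upsilon>, of x] that by simp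
  have inj: "x = y" if "\<tau> x = \<tau> y" for x y by (rule permutes_injD[OF \<tau> that])
  have inj': "x = y" if "\<upsilon> x = \<upsilon> y" for x y by (rule permutes_injD[OF \<upsilon> that])
  have sn: "y = z" if "shift_nonroot a y = shift_nonroot a z" for y z
    using that by (auto simp: shift_nonroot_def split: if_splits)
  have ne: "\<tau> x \<noteq> shift_nonroot a y" if "x \<le> a" "\<tau> x \<noteq> 0" for x y
    using le[OF that(1)] that(2) by (auto simp: shift_nonroot_def)
  show "inj_on (root_star a \<tau> \<upsilon>) {0..a + b}"
  proof (rule inj_onI)
    fix x y assume eq: "root_star a \<tau> \<upsilon> x = root_star a \<tau> \<upsilon> y"
    consider "x \<le> a \<and> \<tau> x \<noteq> 0" "y \<le> a \<and> \<tau> y \<noteq> 0" | "x \<le> a \<and> \<tau> x \<noteq> 0" "\<not> (y \<le> a \<and> \<tau> y \<noteq> 0)"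
      | "\<not> (x \<le> a \<and> \<tau> x \<noteq> 0)" "y \<le> a \<and> \<tau> y \<noteq> 0" | "\<not> (x \<le> a \<and> \<tau> x \<noteq> 0)" "\<not> (y \<le> a \<and> \<tau> y \<noteq> 0)" by blast
    then show "x = y"
    proof cases
      case 1
      then show ?thesis using eq inj by (simp add: app)
    next
      case 2
      have "\<tau> x = shift_nonroot a (\<upsilon> (y - a))"
        using eq unfolding app if_P[OF 2(1)] if_not_P[OF 2(2)] .
      then show ?thesis using ne 2(1) by blast
    next
      case 3
      have "shift_nonroot a (\<upsilon> (x - a)) = \<tau> y"
        using eq unfolding app if_P[OF 3(2)] if_not_P[OF 3(1)] .
      then show ?thesis using ne[of y "\<upsilon> (x - a)"] 3(2) by simp
    next
      case 4
      hence "shift_nonroot a (\<upsilon> (x - a)) = shift_nonroot a (\<upsilon> (y - a))"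
        using eq unfolding app[of x] app[of y] if_not_P[OF 4(1)] if_not_P[OF 4(2)] by simp
      hence "x - a = y - a" using sn inj' by blast
      then show ?thesis using 4 inj[of x y] by (cases "x \<le> a"; cases "y \<le> a") auto
    qed
  qed
  show "root_star a \<tau> \<upsilon> x \<in> {0..a + b}" if "x \<in> {0..a + b}" for x
    using that le[of x] le'[of "x - a"] by (auto simp: app shift_nonroot_def)
  show "root_star a \<tau> \<upsilon> x = x" if "x \<notin> {0..a + b}" for x
    using that permutes_not_in[OF \<upsilon>, of "x - a"] by (auto simp: app shift_nonroot_def)
qed simp

lemma perm_oplus_assoc:
  "perm_oplus (a + b) (perm_oplus a \<sigma> \<sigma>') \<sigma>'' = perm_oplus a \<sigma> (perm_oplus b \<sigma>' \<sigma>'')"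
  by (auto simp: perm_oplus_def fun_eq_iff)

lemma root_star_assoc:
  assumes \<tau>: "\<tau> permutes {0..a}" and \<upsilon>: "\<upsilon> permutes {0..b}" and \<omega>: "\<omega> permutes {0..c}"
  shows "root_star (a + b) (root_star a \<tau> \<upsilon>) \<omega> = root_star a \<tau> (root_star b \<upsilon> \<omega>)"
proof
  fix x
  show "root_star (a + b) (root_star a \<tau> \<upsilon>) \<omega> x = root_star a \<tau> (root_star b \<upsilon> \<omega>) x"
    unfolding root_star_apply[OF root_star_permutes[OF \<tau> \<upsilon>] \<omega>]
      root_star_apply[OF \<tau> root_star_permutes[OF \<upsilon> \<omega>]] root_star_apply[OF \<tau> \<upsilon>]
      root_star_apply[OF \<upsilon> \<omega>]
    by (auto simp: shift_nonroot_def)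
qed

text \<open>The last value of a permutation is forced. This is what determines the right factor at the root
  (and, for \<open>\<oplus>\<close>, at the fixed point \<open>0\<close>), where the product does not show it directly.\<close>

lemma permutes_eqI_except_one:
  assumes "p permutes S" "q permutes S" "\<And>x. x \<noteq> z \<Longrightarrow> p x = q x"
  shows "p = q"
proof -
  have "p z = q z"
  proof (rule ccontr)
    assume n: "p z \<noteq> q z"
    obtain x where x: "p x = q z" using permutes_surj[OF assms(1)] by (metis surjD)
    hence "x \<noteq> z" using n by auto
    hence "q x = q z" using assms(3) x by metis
    then show False using \<open>x \<noteq> z\<close> permutes_injD[OF assms(2)] by blast
  qed
  then show ?thesis using assms(3) by (metis ext)
qed

lemma root_star_inject:
  assumes \<tau>: "\<tau> permutes {0..a}" "\<tau>' permutes {0..a}"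
    and \<upsilon>: "\<upsilon> permutes {0..b}" "\<upsilon>' permutes {0..b}"
    and eq: "root_star a \<tau> \<upsilon> = root_star a \<tau>' \<upsilon>'"
  shows "\<tau> = \<tau>' \<and> \<upsilon> = \<upsilon>'"
proof
  have sn: "y = z" if "shift_nonroot a y = shift_nonroot a z" for y z
    using that by (auto simp: shift_nonroot_def split: if_splits)
  have \<upsilon>_eq: "\<upsilon> y = \<upsilon>' y" if "y \<noteq> 0" for y
    using fun_cong[OF eq, of "a + y"] that sn
    by (simp add: root_star_apply[OF \<tau>(1) \<upsilon>(1)] root_star_apply[OF \<tau>(2) \<upsilon>(2)])
  show "\<upsilon> = \<upsilon>'" using permutes_eqI_except_one[OF \<upsilon> \<upsilon>_eq] .
  have le: "\<tau> x \<le> a" "\<tau>' x \<le> a" if "x \<le> a" for x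
    using permutes_in_image[OF \<tau>(1), of x] permutes_in_image[OF \<tau>(2), of x] that by auto
  show "\<tau> = \<tau>'"
  proof
    fix x
    show "\<tau> x = \<tau>' x"
    proof (cases "x \<le> a")
      case True
      then show ?thesis
        using fun_cong[OF eq, of x, unfolded root_star_apply[OF \<tau>(1) \<upsilon>(1)]
            root_star_apply[OF \<tau>(2) \<upsilon>(2)]] le[OF True] \<open>\<upsilon> = \<upsilon>'\<close>
        by (auto simp: shift_nonroot_def split: if_splits)
    next
      case False
      then show ?thesis using permutes_not_in[OF \<tau>(1), of x] permutes_not_in[OF \<tau>(2), of x] by simp
    qed
  qed
qed

lemma perm_oplus_inject:
  assumes \<sigma>: "\<sigma> permutes {1..a}" "\<tau> permutes {1..a}"
    and \<sigma>': "\<sigma>' permutes {1..b}" "\<tau>' permutes {1..b}"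
    and eq: "perm_oplus a \<sigma> \<sigma>' = perm_oplus a \<tau> \<tau>'"
  shows "\<sigma> = \<tau> \<and> \<sigma>' = \<tau>'"
proof
  show "\<sigma> = \<tau>"
  proof
    fix x show "\<sigma> x = \<tau> x"
      using fun_cong[OF eq, of x] permutes_not_in[OF \<sigma>(1), of x] permutes_not_in[OF \<sigma>(2), of x]
      by (cases "x \<le> a") (auto simp: perm_oplus_def)
  qed
  have 1: "\<sigma>' y = \<tau>' y" if "y \<noteq> 0" for y
    using fun_cong[OF eq, of "a + y"] that by (auto simp: perm_oplus_def split: if_splits)
  show "\<sigma>' = \<tau>'" using permutes_eqI_except_one[OF \<sigma>' 1] .
qed

lemma perm_oplus_exists:
  assumes \<rho>: "\<rho> permutes {1..a + b}" and im: "\<rho> ` {1..a} = {1..a}"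
  shows "\<exists>\<sigma> \<sigma>'. \<sigma> permutes {1..a} \<and> \<sigma>' permutes {1..b} \<and> \<rho> = perm_oplus a \<sigma> \<sigma>'"
proof -
  define \<sigma> where "\<sigma> x = (if x \<le> a then \<rho> x else x)" for x
  define \<sigma>' where "\<sigma>' y = (if y = 0 then 0 else \<rho> (a + y) - a)" for y
  have \<rho>0: "\<rho> 0 = 0" using permutes_not_in[OF \<rho>] by simp
  have inj: "x = y" if "\<rho> x = \<rho> y" for x y by (rule permutes_injD[OF \<rho> that])
  have up: "a < \<rho> x" if "a < x" for x
  proof (rule ccontr)
    assume n: "\<not> a < \<rho> x"
    have "\<rho> x \<noteq> 0" using inj[of x 0] \<rho>0 that by auto
    hence "\<rho> x \<in> \<rho> ` {1..a}" using n unfolding im by auto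
    then obtain y where "y \<in> {1..a}" "\<rho> x = \<rho> y" by blast
    then show False using inj[of x y] that by auto
  qed
  have "\<sigma> permutes {1..a}"
  proof (rule permutes_finiteI)
    show "inj_on \<sigma> {1..a}"
      by (rule inj_onI) (auto simp: \<sigma>_def intro: inj)
    show "\<sigma> x \<in> {1..a}" if "x \<in> {1..a}" for x using that im by (auto simp: \<sigma>_def)
    show "\<sigma> x = x" if "x \<notin> {1..a}" for x using that \<rho>0 by (auto simp: \<sigma>_def not_le)
  qed simp
  moreover have "\<sigma>' permutes {1..b}"
  proof (rule permutes_finiteI)
    show "inj_on \<sigma>' {1..b}"
    proof (rule inj_onI)
      fix x y assume "x \<in> {1..b}" "y \<in> {1..b}" "\<sigma>' x = \<sigma>' y"
      hence "\<rho> (a + x) = \<rho> (a + y)" using up[of "a + x"] up[of "a + y"] by (simp add: \<sigma>'_def)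
      then show "x = y" using inj[of "a + x" "a + y"] by simp
    qed
    show "\<sigma>' x \<in> {1..b}" if "x \<in> {1..b}" for x
      using that up[of "a + x"] permutes_in_image[OF \<rho>, of "a + x"] by (auto simp: \<sigma>'_def)
    show "\<sigma>' x = x" if "x \<notin> {1..b}" for x
      using that permutes_not_in[OF \<rho>, of "a + x"] by (auto simp: \<sigma>'_def)
  qed simp
  moreover have "\<rho> = perm_oplus a \<sigma> \<sigma>'"
  proof
    fix x show "\<rho> x = perm_oplus a \<sigma> \<sigma>' x"
      using up[of x] by (auto simp: perm_oplus_def \<sigma>_def \<sigma>'_def)
  qed
  ultimately show ?thesis by blast
qed

text \<open>The arrows of \<open>\<rho>\<close> that start at letters above \<open>a\<close> give \<open>\<upsilon>\<close> everywhere except at the root;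
  they miss exactly one value, which becomes \<open>\<upsilon> 0\<close>. The left factor is obtained from \<open>\<rho>\<close> by
  sending every arrow that leaves \<open>{0..a}\<close> to the root instead. Since the values of \<open>\<upsilon>\<close> off the root
  are used up by high letters, at most one element of \<open>{0..a}\<close> has an arrow to the root or
  beyond \<open>a\<close>, so the result is injective.\<close>

lemma root_star_exists:
  assumes \<rho>: "\<rho> permutes {0..a + b}" and up: "stays_above a \<rho>"
  shows "\<exists>\<tau> \<upsilon>. \<tau> permutes {0..a} \<and> \<upsilon> permutes {0..b} \<and> \<rho> = root_star a \<tau> \<upsilon>"
proof -
  have inj: "x = y" if "\<rho> x = \<rho> y" for x y by (rule permutes_injD[OF \<rho> that])
  define g where "g y = \<rho> (a + y) - a" for y
  have sg: "\<rho> (a + y) = shift_nonroot a (g y)" if "0 < y" for y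
  proof -
    have "\<rho> (a + y) = 0 \<or> a < \<rho> (a + y)" using up that unfolding stays_above_def by simp
    then show ?thesis by (auto simp: g_def shift_nonroot_def)
  qed
  have g_inj: "inj_on g {1..b}"
  proof (rule inj_onI)
    fix x y assume "x \<in> {1..b}" "y \<in> {1..b}" "g x = g y"
    hence "\<rho> (a + x) = \<rho> (a + y)" using sg by simp
    then show "x = y" using inj[of "a + x" "a + y"] by simp
  qed
  have g_in: "g ` {1..b} \<subseteq> {0..b}"
  proof
    fix z assume "z \<in> g ` {1..b}"
    then obtain y where "y \<in> {1..b}" "z = g y" by blast
    then show "z \<in> {0..b}" using permutes_in_image[OF \<rho>, of "a + y"] by (auto simp: g_def)
  qed
  \<comment> \<open>the one value in \<open>{0..b}\<close> that is missed is the only possible value at the root\<close>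
  have "card (g ` {1..b}) = b" using card_image[OF g_inj] by simp
  hence "g ` {1..b} \<noteq> {0..b}" by (metis Suc_eq_plus1 card_atLeastAtMost diff_zero n_not_Suc_n)
  then obtain m where m: "m \<in> {0..b}" "m \<notin> g ` {1..b}" using g_in by blast
  define \<upsilon> where "\<upsilon> y = (if y = 0 then m else if y \<le> b then g y else y)" for y
  have \<upsilon>: "\<upsilon> permutes {0..b}"
  proof (rule permutes_finiteI)
    show "inj_on \<upsilon> {0..b}"
    proof (rule inj_onI)
      fix x y assume "x \<in> {0..b}" "y \<in> {0..b}" "\<upsilon> x = \<upsilon> y"
      then show "x = y" using m(2) inj_onD[OF g_inj, of x y]
        by (cases "x = 0"; cases "y = 0") (auto simp: \<upsilon>_def)
    qed
    show "\<upsilon> x \<in> {0..b}" if "x \<in> {0..b}" for x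
      using that m(1) subsetD[OF g_in, of "g x"] by (auto simp: \<upsilon>_def)
  qed (auto simp: \<upsilon>_def)
  have \<upsilon>': "shift_nonroot a (\<upsilon> (x - a)) = \<rho> x" if "a < x" for x
  proof (cases "x \<le> a + b")
    case True
    then show ?thesis using that sg[of "x - a"] by (auto simp: \<upsilon>_def)
  next
    case False
    then show ?thesis using that permutes_not_in[OF \<rho>, of x] by (auto simp: \<upsilon>_def shift_nonroot_def)
  qed
  define \<tau> where "\<tau> x = (if x \<le> a then (if \<rho> x \<le> a then \<rho> x else 0) else x)" for x
  \<comment> \<open>an edge from \<open>{0..a}\<close> to \<open>0\<close> or beyond \<open>a\<close> must hit the image of \<open>\<upsilon> 0\<close>, since the
    other candidates are already taken\<close>
  have val: "\<rho> x = shift_nonroot a (\<upsilon> 0)" if "x \<le> a" "\<rho> x = 0 \<or> a < \<rho> x" for x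
  proof -
    have "\<rho> x - a \<in> {0..b}" using permutes_in_image[OF \<rho>, of x] that by auto
    then obtain z where z: "\<upsilon> z = \<rho> x - a" "z \<in> {0..b}"
      using permutes_image[OF \<upsilon>] by (metis imageE)
    have \<rho>x: "\<rho> x = shift_nonroot a (\<upsilon> z)" using that(2) z(1) by (auto simp: shift_nonroot_def)
    have "z = 0"
    proof (rule ccontr)
      assume "z \<noteq> 0"
      hence "\<rho> x = \<rho> (a + z)" using \<rho>x \<upsilon>'[of "a + z"] by simp
      then show False using inj[of x "a + z"] \<open>z \<noteq> 0\<close> that(1) by simp
    qed
    then show ?thesis using \<rho>x by simp
  qed
  have \<tau>: "\<tau> permutes {0..a}"
  proof (rule permutes_finiteI)
    show "inj_on \<tau> {0..a}"
    proof (rule inj_onI)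
      fix x y assume "x \<in> {0..a}" "y \<in> {0..a}" "\<tau> x = \<tau> y"
      hence "\<rho> x = \<rho> y" using val[of x] val[of y] by (auto simp: \<tau>_def split: if_splits)
      then show "x = y" using inj by simp
    qed
  qed (auto simp: \<tau>_def)
  have "\<rho> = root_star a \<tau> \<upsilon>"
  proof
    fix x show "\<rho> x = root_star a \<tau> \<upsilon> x"
      unfolding root_star_apply[OF \<tau> \<upsilon>] using val[of x] \<upsilon>'[of x]
      by (cases "x \<le> a") (auto simp: \<tau>_def)
  qed
  then show ?thesis using \<tau> \<upsilon> by blast
qed

lemma image_perm_oplus:
  assumes "d \<le> a"
  shows "perm_oplus a \<sigma> \<sigma>' ` {1..d} = \<sigma> ` {1..d}"
  using assms by (intro image_cong) (auto simp: perm_oplus_def)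

text \<open>Below the cut, the arrows of the product agree with those of \<open>\<tau>\<close> except for arrows to the root,
  which are redirected to the root or to letters above \<open>a\<close>, and both are harmless. Above the cut,
  the arrows are those of \<open>\<upsilon>\<close>, shifted.\<close>

lemma stays_above_root_star:
  assumes \<tau>: "\<tau> permutes {0..a}" and \<upsilon>: "\<upsilon> permutes {0..b}"
  shows "d \<le> a \<Longrightarrow> stays_above d (root_star a \<tau> \<upsilon>) \<longleftrightarrow> stays_above d \<tau>"
    and "stays_above (a + e) (root_star a \<tau> \<upsilon>) \<longleftrightarrow> stays_above e \<upsilon>"
proof -
  note app = root_star_apply[OF \<tau> \<upsilon>]
  assume d: "d \<le> a"
  show "stays_above d (root_star a \<tau> \<upsilon>) \<longleftrightarrow> stays_above d \<tau>"
  proof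
    assume *: "stays_above d (root_star a \<tau> \<upsilon>)"
    show "stays_above d \<tau>" unfolding stays_above_def
    proof (intro allI impI)
      fix x assume "d < x"
      then show "\<tau> x = 0 \<or> d < \<tau> x"
        using * permutes_not_in[OF \<tau>, of x] unfolding stays_above_def app
        by (cases "x \<le> a") (auto split: if_splits)
    qed
  next
    assume "stays_above d \<tau>"
    then show "stays_above d (root_star a \<tau> \<upsilon>)"
      using d unfolding stays_above_def app by (auto simp: shift_nonroot_def)
  qed
next
  note app = root_star_apply[OF \<tau> \<upsilon>]
  show "stays_above (a + e) (root_star a \<tau> \<upsilon>) \<longleftrightarrow> stays_above e \<upsilon>"
  proof
    assume *: "stays_above (a + e) (root_star a \<tau> \<upsilon>)"
    show "stays_above e \<upsilon>" unfolding stays_above_def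
    proof (intro allI impI)
      fix y assume "e < y"
      hence "root_star a \<tau> \<upsilon> (a + y) = 0 \<or> a + e < root_star a \<tau> \<upsilon> (a + y)"
        using * unfolding stays_above_def by simp
      then show "\<upsilon> y = 0 \<or> e < \<upsilon> y"
        using \<open>e < y\<close> unfolding app by (auto simp: shift_nonroot_def split: if_splits)
    qed
  next
    assume *: "stays_above e \<upsilon>"
    show "stays_above (a + e) (root_star a \<tau> \<upsilon>)" unfolding stays_above_def
    proof (intro allI impI)
      fix x assume "a + e < x"
      hence "e < x - a" "\<not> x \<le> a" by auto
      then show "root_star a \<tau> \<upsilon> x = 0 \<or> a + e < root_star a \<tau> \<upsilon> x"
        using * unfolding stays_above_def app by (auto simp: shift_nonroot_def)
    qed
  qed
qed

lemma image_perm_oplus_beyond: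
  assumes \<sigma>: "\<sigma> permutes {1..a}" and \<sigma>': "\<sigma>' permutes {1..b}"
  shows "perm_oplus a \<sigma> \<sigma>' ` {1..a + e} = {1..a + e} \<longleftrightarrow> \<sigma>' ` {1..e} = {1..e}"
proof -
  have split: "{1..a + e} = {1..a} \<union> (+) a ` {1..e}"
    by (auto simp: image_iff)
  have pos: "1 \<le> \<sigma>' y" if "1 \<le> y" for y
    using that permutes_in_image[OF \<sigma>', of y] permutes_not_in[OF \<sigma>', of y] by fastforce
  have "perm_oplus a \<sigma> \<sigma>' ` {1..a + e} = {1..a} \<union> (+) a ` \<sigma>' ` {1..e}"
  proof -
    have "perm_oplus a \<sigma> \<sigma>' ` (+) a ` {1..e} = (+) a ` \<sigma>' ` {1..e}"
      unfolding image_image by (intro image_cong) (auto simp: perm_oplus_def)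
    then show ?thesis
      unfolding split image_Un image_perm_oplus[OF order_refl] permutes_image[OF \<sigma>] by simp
  qed
  moreover have "{1..a} \<inter> (+) a ` \<sigma>' ` {1..e} = {}" "{1..a} \<inter> (+) a ` {1..e} = {}"
    using pos by fastforce+
  moreover have "A \<union> X = A \<union> Y \<longleftrightarrow> X = Y" if "A \<inter> X = {}" "A \<inter> Y = {}" for A X Y :: "nat set"
    using that by blast
  ultimately have "perm_oplus a \<sigma> \<sigma>' ` {1..a + e} = {1..a + e} \<longleftrightarrow>
      (+) a ` \<sigma>' ` {1..e} = (+) a ` {1..e}"
    unfolding split by presburger
  also have "\<dots> \<longleftrightarrow> \<sigma>' ` {1..e} = {1..e}"
    by (rule inj_image_eq_iff) simp
  finally show ?thesis .
qed

lemma halves_add: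
  assumes "\<not> (odd a \<and> odd b)"
  shows "upper_half (a + b) = upper_half a + upper_half b"
    and "lower_half (a + b) = lower_half a + lower_half b"
  using assms by (cases "even a"; cases "even b"; auto simp: upper_half_def lower_half_def elim!: evenE oddE)+

lemma halves_mono:
  assumes "a \<le> b"
  shows "upper_half a \<le> upper_half b" "lower_half a \<le> lower_half b"
  using assms unfolding upper_half_def lower_half_def by (simp_all add: div_le_mono)

lemma decorations_permutes:
  assumes "\<xi> \<in> decorations a"
  shows "fst \<xi> permutes {1..upper_half a}" "snd \<xi> permutes {0..lower_half a}"
  using assms by (auto simp: decorations_def)

lemma diamond_decorations:
  assumes "\<not> (odd a \<and> odd b)" "\<xi> \<in> decorations a" "\<zeta> \<in> decorations b"
  shows "diamond a \<xi> \<zeta> \<in> decorations (a + b)"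
  using perm_oplus_permutes[OF decorations_permutes(1)[OF assms(2)] decorations_permutes(1)[OF assms(3)]]
    root_star_permutes[OF decorations_permutes(2)[OF assms(2)] decorations_permutes(2)[OF assms(3)]]
  by (simp add: diamond_def decorations_def halves_add[OF assms(1)])

lemma diamond_assoc:
  assumes "\<not> (odd a \<and> odd b)" "\<xi> \<in> decorations a" "\<zeta> \<in> decorations b" "\<eta> \<in> decorations c"
  shows "diamond (a + b) (diamond a \<xi> \<zeta>) \<eta> = diamond a \<xi> (diamond b \<zeta> \<eta>)"
  using root_star_assoc[OF decorations_permutes(2)[OF assms(2)] decorations_permutes(2)[OF assms(3)]
      decorations_permutes(2)[OF assms(4)]]
  by (simp add: diamond_def perm_oplus_assoc halves_add[OF assms(1)])

lemma diamond_inject: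
  assumes "\<xi> \<in> decorations a" "\<xi>' \<in> decorations a" "\<zeta> \<in> decorations b" "\<zeta>' \<in> decorations b"
    and "diamond a \<xi> \<zeta> = diamond a \<xi>' \<zeta>'"
  shows "\<xi> = \<xi>' \<and> \<zeta> = \<zeta>'"
proof -
  have "perm_oplus (upper_half a) (fst \<xi>) (fst \<zeta>) = perm_oplus (upper_half a) (fst \<xi>') (fst \<zeta>')"
    and "root_star (lower_half a) (snd \<xi>) (snd \<zeta>) = root_star (lower_half a) (snd \<xi>') (snd \<zeta>')"
    using assms(5) by (simp_all add: diamond_def)
  from perm_oplus_inject[OF assms(1-4)[THEN decorations_permutes(1)] this(1)]
    root_star_inject[OF assms(1-4)[THEN decorations_permutes(2)] this(2)]
  show ?thesis by (simp add: prod_eq_iff)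
qed

text \<open>The parity condition on \<open>e\<close> makes the halves of \<open>c + e\<close> the sums of the halves; in the
  application both \<open>c\<close> and \<open>c + e\<close> are cuts of a composition with at most one odd part.\<close>

lemma factorization_cut_diamond:
  assumes par: "\<not> (odd c \<and> odd m)" and L: "\<theta>\<^sub>L \<in> decorations c" and R: "\<theta>\<^sub>R \<in> decorations m"
  shows "d \<le> c \<Longrightarrow> factorization_cut (c + m) (diamond c \<theta>\<^sub>L \<theta>\<^sub>R) d \<longleftrightarrow> factorization_cut c \<theta>\<^sub>L d"
    and "\<not> (odd c \<and> odd e) \<Longrightarrow>
      factorization_cut (c + m) (diamond c \<theta>\<^sub>L \<theta>\<^sub>R) (c + e) \<longleftrightarrow> factorization_cut m \<theta>\<^sub>R e"
proof -
  note D = factorization_cut_iff[OF diamond_decorations[OF par L R]]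
  note pL = decorations_permutes[OF L] and pR = decorations_permutes[OF R]
  { assume d: "d \<le> c"
    have *: "fst (diamond c \<theta>\<^sub>L \<theta>\<^sub>R) ` {1..upper_half d} = fst \<theta>\<^sub>L ` {1..upper_half d}"
      using image_perm_oplus[OF halves_mono(1)[OF d]] by (simp add: diamond_def)
    show "factorization_cut (c + m) (diamond c \<theta>\<^sub>L \<theta>\<^sub>R) d \<longleftrightarrow> factorization_cut c \<theta>\<^sub>L d"
      unfolding D factorization_cut_iff[OF L] *
      using stays_above_root_star(1)[OF pL(2) pR(2) halves_mono(2)[OF d]]
      by (simp add: diamond_def) }
  { assume e: "\<not> (odd c \<and> odd e)"
    show "factorization_cut (c + m) (diamond c \<theta>\<^sub>L \<theta>\<^sub>R) (c + e) \<longleftrightarrow> factorization_cut m \<theta>\<^sub>R e"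
      unfolding D factorization_cut_iff[OF R]
      using stays_above_root_star(2)[OF pL(2) pR(2), of "lower_half e"]
        image_perm_oplus_beyond[OF pL(1) pR(1), of "upper_half e"]
      unfolding halves_add[OF e] diamond_def fst_conv snd_conv by argo }
qed

lemma factorization_cut_full:
  assumes "\<theta> \<in> decorations n"
  shows "factorization_cut n \<theta> n"
  unfolding factorization_cut_iff[OF assms]
  using permutes_image[OF decorations_permutes(1)[OF assms]]
    permutes_not_in[OF decorations_permutes(2)[OF assms]] by (simp add: stays_above_def)

lemma diamond_exists:
  assumes par: "\<not> (odd c \<and> odd m)" and \<theta>: "\<theta> \<in> decorations (c + m)"
    and cut: "factorization_cut (c + m) \<theta> c"
  shows "\<exists>\<theta>\<^sub>L\<in>decorations c. \<exists>\<theta>\<^sub>R\<in>decorations m. \<theta> = diamond c \<theta>\<^sub>L \<theta>\<^sub>R"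
proof -
  note p = decorations_permutes[OF \<theta>, unfolded halves_add[OF par]]
  from cut have c: "fst \<theta> ` {1..upper_half c} = {1..upper_half c}"
      "stays_above (lower_half c) (snd \<theta>)"
    unfolding factorization_cut_iff[OF \<theta>] by auto
  obtain \<sigma> \<sigma>' where 1: "\<sigma> permutes {1..upper_half c}" "\<sigma>' permutes {1..upper_half m}"
      "fst \<theta> = perm_oplus (upper_half c) \<sigma> \<sigma>'"
    using perm_oplus_exists[OF p(1) c(1)] by blast
  obtain \<tau> \<upsilon> where 2: "\<tau> permutes {0..lower_half c}" "\<upsilon> permutes {0..lower_half m}"
      "snd \<theta> = root_star (lower_half c) \<tau> \<upsilon>"
    using root_star_exists[OF p(2) c(2)] by blast
  have "\<theta> = diamond c (\<sigma>, \<tau>) (\<sigma>', \<upsilon>)" using 1(3) 2(3) by (simp add: diamond_def prod_eq_iff)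
  moreover have "(\<sigma>, \<tau>) \<in> decorations c" "(\<sigma>', \<upsilon>) \<in> decorations m"
    using 1 2 by (auto simp: decorations_def)
  ultimately show ?thesis by blast
qed

lemma is_factorization_ex1:
  assumes "c \<le> n" "\<not> (odd c \<and> odd (n - c))" "\<theta> \<in> decorations n" "factorization_cut n \<theta> c"
  shows "\<exists>!\<theta>s. is_factorization n c \<theta> \<theta>s"
proof -
  obtain L R where LR: "L \<in> decorations c" "R \<in> decorations (n - c)" "\<theta> = diamond c L R"
    using diamond_exists[of c "n - c" \<theta>] assms by auto
  show ?thesis
  proof (rule ex1I[of _ "(L, R)"])
    show "is_factorization n c \<theta> (L, R)" using LR by (simp add: is_factorization_def)
    fix \<theta>s assume *: "is_factorization n c \<theta> \<theta>s"
    obtain L' R' where \<theta>s: "\<theta>s = (L', R')" by (cases \<theta>s)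
    have "L' \<in> decorations c" "R' \<in> decorations (n - c)" "diamond c L' R' = diamond c L R"
      using * LR(3) unfolding is_factorization_def \<theta>s by auto
    then show "\<theta>s = (L, R)" using diamond_inject[OF _ LR(1) _ LR(2)] \<theta>s by blast
  qed
qed

section \<open>Compositions and their cut sets\<close>

lemma composition_append:
  "composition (xs @ ys) n \<longleftrightarrow>
    composition xs (sum_list xs) \<and> composition ys (sum_list ys) \<and> sum_list xs + sum_list ys = n"
  by (auto simp: composition_def)

lemma composition_pos: "composition \<alpha> n \<Longrightarrow> \<alpha> \<noteq> [] \<longleftrightarrow> 0 < n"
  by (cases \<alpha>) (auto simp: composition_def)

lemma psum_append:
  "psum (xs @ ys) p = (if p \<le> length xs then psum xs p else sum_list xs + psum ys (p - length xs))"
  by (simp add: psum_def)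

lemma psum_less:
  assumes "composition \<alpha> n" "i < j" "j \<le> length \<alpha>"
  shows "psum \<alpha> i < psum \<alpha> j"
proof -
  have "take j \<alpha> = take i \<alpha> @ take (j - i) (drop i \<alpha>)"
    using assms(2) by (metis le_add_diff_inverse less_imp_le take_add)
  moreover obtain x xs where x: "take (j - i) (drop i \<alpha>) = x # xs"
    using assms by (cases "take (j - i) (drop i \<alpha>)") auto
  moreover have "x \<in> set \<alpha>" using x by (metis in_set_dropD in_set_takeD list.set_intros(1))
  ultimately show ?thesis using assms(1) by (simp add: psum_def composition_def)
qed

lemma psum_mono_iff:
  assumes "composition \<alpha> n" "i \<le> length \<alpha>" "j \<le> length \<alpha>"
  shows "psum \<alpha> i \<le> psum \<alpha> j \<longleftrightarrow> i \<le> j"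
  using psum_less[OF assms(1), of i j] psum_less[OF assms(1), of j i] assms(2,3)
  by (metis le_neq_implies_less linorder_not_less order.strict_iff_not order_refl)

lemma psum_length: "psum \<alpha> (length \<alpha>) = sum_list \<alpha>"
  by (simp add: psum_def)

lemma cut_set_bounds:
  assumes "composition \<alpha> n" "d \<in> cut_set \<alpha>"
  shows "0 < d" "d < n"
proof -
  obtain p where p: "d = psum \<alpha> p" "1 \<le> p" "p < length \<alpha>" using assms(2) by (auto simp: cut_set_def)
  have "psum \<alpha> 0 < psum \<alpha> p" "psum \<alpha> p < psum \<alpha> (length \<alpha>)" using psum_less[OF assms(1)] p by auto
  then show "0 < d" "d < n" using p assms(1) unfolding psum_length by (auto simp: composition_def)
qed

lemma cut_set_append:
  assumes "xs \<noteq> []" "ys \<noteq> []"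
  shows "cut_set (xs @ ys) = cut_set xs \<union> {sum_list xs} \<union> (+) (sum_list xs) ` cut_set ys"
proof (intro equalityI subsetI)
  fix d assume "d \<in> cut_set (xs @ ys)"
  then obtain p where p: "d = psum (xs @ ys) p" "1 \<le> p" "p < length xs + length ys"
    by (auto simp: cut_set_def)
  consider "p < length xs" | "p = length xs" | "length xs < p" by linarith
  then show "d \<in> cut_set xs \<union> {sum_list xs} \<union> (+) (sum_list xs) ` cut_set ys"
  proof cases
    case 1
    then show ?thesis using p by (auto simp: cut_set_def psum_append)
  next
    case 2
    then show ?thesis using p by (simp add: psum_append psum_length)
  next
    case 3
    hence "psum ys (p - length xs) \<in> cut_set ys"
      unfolding cut_set_def using p by (intro CollectI exI[of _ "p - length xs"]) auto
    then show ?thesis using 3 p by (simp add: psum_append)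
  qed
next
  fix d assume d: "d \<in> cut_set xs \<union> {sum_list xs} \<union> (+) (sum_list xs) ` cut_set ys"
  have wit: "psum (xs @ ys) p \<in> cut_set (xs @ ys)" if "1 \<le> p" "p < length xs + length ys" for p
    using that by (auto simp: cut_set_def)
  consider p where "d = psum xs p" "1 \<le> p" "p < length xs" | "d = sum_list xs"
    | p where "d = sum_list xs + psum ys p" "1 \<le> p" "p < length ys"
    using d by (auto simp: cut_set_def)
  then show "d \<in> cut_set (xs @ ys)"
  proof cases
    case 1
    then show ?thesis using wit[of p] by (simp add: psum_append)
  next
    case 2
    have "1 \<le> length xs" "length xs < length xs + length ys" using assms by (auto simp: Suc_le_eq)
    then show ?thesis using wit[of "length xs"] 2 by (simp add: psum_append psum_length)
  next
    case 3
    then show ?thesis using wit[of "length xs + p"] by (simp add: psum_append)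
  qed
qed

lemma cut_set_singleton [simp]: "cut_set [a] = {}"
  by (auto simp: cut_set_def)

lemma cut_set_Nil [simp]: "cut_set [] = {}"
  by (auto simp: cut_set_def)

lemma cut_set_snoc: "xs \<noteq> [] \<Longrightarrow> cut_set (xs @ [a]) = insert (sum_list xs) (cut_set xs)"
  by (simp add: cut_set_append)

text \<open>The largest cut is the sum of all parts but the last; removing it leaves the cut set of the
  composition without its last part.\<close>

lemma composition_eqI:
  assumes "composition \<alpha> n" "composition \<beta> n" "cut_set \<alpha> = cut_set \<beta>"
  shows "\<alpha> = \<beta>"
  using assms
proof (induct \<alpha> arbitrary: \<beta> n rule: rev_induct)
  case Nil
  then show ?case using composition_pos by (metis composition_def sum_list.Nil less_irrefl)
next
  case (snoc a xs)
  have "0 < n" using composition_pos[OF snoc.prems(1)] by simp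
  hence "\<beta> \<noteq> []" using composition_pos[OF snoc.prems(2)] by simp
  then obtain ys b where \<beta>: "\<beta> = ys @ [b]" by (metis rev_exhaust)
  have xs: "composition xs (sum_list xs)" and ys: "composition ys (sum_list ys)"
    and n: "sum_list xs + a = n" "sum_list ys + b = n"
    using snoc.prems(1,2) unfolding \<beta> composition_append by simp_all
  have empty: "cut_set (zs @ [c]) = {} \<longleftrightarrow> zs = []" for zs and c :: nat
    by (cases "zs = []") (auto simp: cut_set_snoc)
  show ?case
  proof (cases "xs = []")
    case True
    hence "ys = []" using snoc.prems(3) empty unfolding \<beta> by metis
    then show ?thesis using True n \<beta> by simp
  next
    case False
    hence ne: "ys \<noteq> []" using snoc.prems(3) empty unfolding \<beta> by metis
    have eq: "insert (sum_list xs) (cut_set xs) = insert (sum_list ys) (cut_set ys)"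
      using snoc.prems(3) False ne unfolding \<beta> by (simp add: cut_set_snoc)
    have x: "d < sum_list xs" if "d \<in> cut_set xs" for d using cut_set_bounds[OF xs that] by simp
    have y: "d < sum_list ys" if "d \<in> cut_set ys" for d using cut_set_bounds[OF ys that] by simp
    \<comment> \<open>the last partial sum is the largest cut\<close>
    have s: "sum_list xs = sum_list ys"
      using eq x y by (metis insertCI insertE less_asym)
    hence "cut_set xs = cut_set ys" using eq x y by (metis insert_ident less_irrefl)
    hence "xs = ys" using snoc.hyps xs ys s by metis
    then show ?thesis using n \<beta> by simp
  qed
qed

lemma composition_with_cuts_exists:
  "S \<subseteq> {0<..<n} \<Longrightarrow> \<exists>\<gamma>. composition \<gamma> n \<and> cut_set \<gamma> = S"
proof (induct n arbitrary: S rule: less_induct)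
  case (less n)
  show ?case
  proof (cases "S = {}")
    case True
    show ?thesis
    proof (cases "n = 0")
      case True
      then show ?thesis using \<open>S = {}\<close> by (intro exI[of _ "[]"]) (simp add: composition_def)
    next
      case False
      then show ?thesis using \<open>S = {}\<close> by (intro exI[of _ "[n]"]) (simp add: composition_def)
    qed
  next
    case False
    have fin: "finite S" using less.prems finite_subset by blast
    define m where "m = Max S"
    have mS: "m \<in> S" using False fin by (simp add: m_def)
    hence m: "0 < m" "m < n" using less.prems by auto
    have "S - {m} \<subseteq> {0<..<m}"
    proof
      fix x assume x: "x \<in> S - {m}"
      hence "x \<le> m" "x \<noteq> m" using Max_ge[OF fin, of x] by (auto simp: m_def)
      then show "x \<in> {0<..<m}" using x less.prems by auto
    qed
    then obtain \<gamma> where \<gamma>: "composition \<gamma> m" "cut_set \<gamma> = S - {m}" using less.hyps[OF m(2)] by blast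
    have "\<gamma> \<noteq> []" using composition_pos[OF \<gamma>(1)] m by simp
    hence "cut_set (\<gamma> @ [n - m]) = S"
      using \<gamma> mS by (auto simp: cut_set_snoc composition_def)
    moreover have "composition (\<gamma> @ [n - m]) n" using \<gamma> m by (auto simp: composition_def)
    ultimately show ?thesis by blast
  qed
qed

lemma composition_of_cuts:
  assumes "S \<subseteq> {0<..<n}"
  shows "composition (composition_of_cuts n S) n" "cut_set (composition_of_cuts n S) = S"
proof -
  have "\<exists>!\<gamma>. composition \<gamma> n \<and> cut_set \<gamma> = S"
    using composition_with_cuts_exists[OF assms] composition_eqI by blast
  from theI'[OF this, folded composition_of_cuts_def]
  show "composition (composition_of_cuts n S) n" "cut_set (composition_of_cuts n S) = S" by auto
qed

lemma odd_sum_list: "odd (sum_list xs) \<longleftrightarrow> odd (length (filter odd (xs :: nat list)))"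
  by (induct xs) auto

lemma at_most_one_odd_append:
  assumes "at_most_one_odd (xs @ ys)"
  shows "at_most_one_odd xs" "at_most_one_odd ys" "\<not> (odd (sum_list xs) \<and> odd (sum_list ys))"
  using assms by (auto simp: at_most_one_odd_def odd_sum_list elim!: oddE)

text \<open>Partial sums change parity exactly at odd parts, so a single odd part means that the parity can
  only change once, from even to odd. In this form the condition visibly passes to smaller cut
  sets.\<close>

lemma at_most_one_odd_iff:
  assumes "composition \<alpha> n"
  shows "at_most_one_odd \<alpha> \<longleftrightarrow>
    (\<forall>d\<in>insert n (cut_set \<alpha>). \<forall>e\<in>insert n (cut_set \<alpha>). d \<le> e \<longrightarrow> odd d \<longrightarrow> odd e)"
proof
  assume one: "at_most_one_odd \<alpha>"
  have D: "\<exists>p\<le>length \<alpha>. d = psum \<alpha> p" if "d \<in> insert n (cut_set \<alpha>)" for d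
    using that assms psum_length[of \<alpha>] by (auto simp: cut_set_def composition_def intro: less_imp_le)
  show "\<forall>d\<in>insert n (cut_set \<alpha>). \<forall>e\<in>insert n (cut_set \<alpha>). d \<le> e \<longrightarrow> odd d \<longrightarrow> odd e"
  proof (intro ballI impI)
    fix d e assume d: "d \<in> insert n (cut_set \<alpha>)" and e: "e \<in> insert n (cut_set \<alpha>)"
      and le: "d \<le> e" and odd: "odd d"
    obtain i j where i: "i \<le> length \<alpha>" "d = psum \<alpha> i" and j: "j \<le> length \<alpha>" "e = psum \<alpha> j"
      using D d e by meson
    have "i \<le> j" using le psum_mono_iff[OF assms i(1) j(1)] i j by simp
    hence take_j: "take j \<alpha> = take i \<alpha> @ take (j - i) (drop i \<alpha>)"
      by (metis le_add_diff_inverse take_add)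
    have "at_most_one_odd (take j \<alpha>)"
      using one at_most_one_odd_append(1)[of "take j \<alpha>" "drop j \<alpha>"] by simp
    hence "\<not> (odd d \<and> odd (sum_list (take (j - i) (drop i \<alpha>))))"
      unfolding take_j i(2) psum_def by (rule at_most_one_odd_append(3))
    then show "odd e" using odd i(2) unfolding j(2) psum_def take_j by simp
  qed
next
  assume "\<forall>d\<in>insert n (cut_set \<alpha>). \<forall>e\<in>insert n (cut_set \<alpha>). d \<le> e \<longrightarrow> odd d \<longrightarrow> odd e"
  then show "at_most_one_odd \<alpha>"
    using assms
  proof (induct \<alpha> arbitrary: n rule: rev_induct)
    case Nil
    then show ?case by (simp add: at_most_one_odd_def)
  next
    case (snoc a xs)
    show ?case
    proof (cases "xs = []")
      case True
      then show ?thesis by (simp add: at_most_one_odd_def)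
    next
      case False
      have xs: "composition xs (sum_list xs)" and n: "sum_list xs + a = n"
        using snoc.prems(2) unfolding composition_append by simp_all
      have sub: "insert (sum_list xs) (cut_set xs) \<subseteq> insert n (cut_set (xs @ [a]))"
        using False by (auto simp: cut_set_snoc)
      have one: "at_most_one_odd xs"
        by (rule snoc.hyps[OF _ xs]) (use snoc.prems(1) sub in blast)
      have "odd n" if "odd (sum_list xs)"
        using snoc.prems(1)[rule_format, of "sum_list xs" n] sub n that by simp
      hence "even (sum_list xs)" if "odd a" using that n by (metis even_add)
      hence "even (length (filter odd xs))" if "odd a" using that odd_sum_list by blast
      moreover have "length (filter odd xs) = 0 \<or> length (filter odd xs) = 1"
        using one by (auto simp: at_most_one_odd_def le_Suc_eq)
      ultimately show ?thesis by (cases "odd a") (auto simp: at_most_one_odd_def)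
    qed
  qed
qed

lemma at_most_one_odd_coarsens:
  assumes "at_most_one_odd \<alpha>" "composition \<alpha> n" "composition \<beta> n" "coarsens \<beta> \<alpha>"
  shows "at_most_one_odd \<beta>"
proof -
  have "insert n (cut_set \<beta>) \<subseteq> insert n (cut_set \<alpha>)" using assms(4) by (auto simp: coarsens_def)
  then show ?thesis
    using assms(1) unfolding at_most_one_odd_iff[OF assms(2)] at_most_one_odd_iff[OF assms(3)]
    by blast
qed

text \<open>The cuts of a concatenation are those of the left part, the junction, and the shifted cuts of the
  right part, and each kind is compared separately with the factors. The junction is always a
  factorization cut, because the full size is one for the left factor.\<close>

lemma factorization_cuts_append:
  assumes \<alpha>: "composition (xs @ ys) n" and one: "at_most_one_odd (xs @ ys)"
    and ne: "xs \<noteq> []" "ys \<noteq> []"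
    and L: "\<theta>\<^sub>L \<in> decorations (sum_list xs)" and R: "\<theta>\<^sub>R \<in> decorations (sum_list ys)"
  shows "factorization_cuts (xs @ ys) (diamond (sum_list xs) \<theta>\<^sub>L \<theta>\<^sub>R) =
    factorization_cuts xs \<theta>\<^sub>L \<union> {sum_list xs} \<union> (+) (sum_list xs) ` factorization_cuts ys \<theta>\<^sub>R"
proof -
  define c m where "c = sum_list xs" and "m = sum_list ys"
  define \<theta> where "\<theta> = diamond c \<theta>\<^sub>L \<theta>\<^sub>R"
  note LR = L[folded c_def] R[folded m_def]
  note p = at_most_one_odd_append(3)[OF one, folded c_def m_def]
  note D = factorization_cut_diamond[OF p LR, folded \<theta>_def]
  have xs: "composition xs c" and ys: "composition ys m"
    using \<alpha> unfolding composition_append c_def m_def by auto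
  have n: "c + m = sum_list (xs @ ys)" by (simp add: c_def m_def)
  have low: "factorization_cut (c + m) \<theta> d \<longleftrightarrow> factorization_cut c \<theta>\<^sub>L d" if "d \<in> cut_set xs" for d
    using D(1) cut_set_bounds(2)[OF xs that] by simp
  have mid: "factorization_cut (c + m) \<theta> c"
    using D(1)[of c] factorization_cut_full[OF LR(1)] by simp
  have high: "factorization_cut (c + m) \<theta> (c + e) \<longleftrightarrow> factorization_cut m \<theta>\<^sub>R e"
    if e: "e \<in> cut_set ys" for e
  proof (rule D(2))
    have "c \<in> cut_set (xs @ ys)" "c + e \<in> cut_set (xs @ ys)"
      using e unfolding cut_set_append[OF ne] c_def by auto
    hence "odd c \<longrightarrow> odd (c + e)"
      using one unfolding at_most_one_odd_iff[OF \<alpha>] by (meson insertI2 le_add1)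
    then show "\<not> (odd c \<and> odd e)" by auto
  qed
  show ?thesis
    unfolding factorization_cuts_def cut_set_append[OF ne] n[symmetric] c_def[symmetric]
      m_def[symmetric] \<theta>_def[symmetric]
    using low mid high by auto
qed

lemma cut_composition_of_factorization_cuts:
  assumes "composition \<alpha> n"
  shows "composition (cut_composition \<alpha> \<theta>) n"
    and "cut_set (cut_composition \<alpha> \<theta>) = factorization_cuts \<alpha> \<theta>"
proof -
  have n: "sum_list \<alpha> = n" using assms by (simp add: composition_def)
  have "factorization_cuts \<alpha> \<theta> \<subseteq> {0<..<n}"
    using cut_set_bounds[OF assms] by (auto simp: factorization_cuts_def)
  from composition_of_cuts[OF this]
  show "composition (cut_composition \<alpha> \<theta>) n"
    and "cut_set (cut_composition \<alpha> \<theta>) = factorization_cuts \<alpha> \<theta>"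
    unfolding cut_composition_def n by auto
qed

lemma cut_composition_append:
  assumes \<alpha>: "composition (xs @ ys) n" and one: "at_most_one_odd (xs @ ys)"
    and ne: "xs \<noteq> []" "ys \<noteq> []"
    and L: "\<theta>\<^sub>L \<in> decorations (sum_list xs)" and R: "\<theta>\<^sub>R \<in> decorations (sum_list ys)"
  shows "cut_composition (xs @ ys) (diamond (sum_list xs) \<theta>\<^sub>L \<theta>\<^sub>R) =
    cut_composition xs \<theta>\<^sub>L @ cut_composition ys \<theta>\<^sub>R"
proof (rule composition_eqI)
  let ?\<theta> = "diamond (sum_list xs) \<theta>\<^sub>L \<theta>\<^sub>R"
  have xs: "composition xs (sum_list xs)" and ys: "composition ys (sum_list ys)"
    and n: "sum_list xs + sum_list ys = n"
    using \<alpha> unfolding composition_append by auto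
  note cx = cut_composition_of_factorization_cuts[OF xs, of \<theta>\<^sub>L]
    and cy = cut_composition_of_factorization_cuts[OF ys, of \<theta>\<^sub>R]
  have sx: "sum_list (cut_composition xs \<theta>\<^sub>L) = sum_list xs"
    and sy: "sum_list (cut_composition ys \<theta>\<^sub>R) = sum_list ys"
    using cx(1) cy(1) by (auto simp: composition_def)
  have ne': "cut_composition xs \<theta>\<^sub>L \<noteq> []" "cut_composition ys \<theta>\<^sub>R \<noteq> []"
    using composition_pos[OF cx(1)] composition_pos[OF cy(1)] composition_pos[OF xs]
      composition_pos[OF ys] ne by auto
  show "composition (cut_composition (xs @ ys) ?\<theta>) n"
    using cut_composition_of_factorization_cuts(1)[OF \<alpha>] .
  show "composition (cut_composition xs \<theta>\<^sub>L @ cut_composition ys \<theta>\<^sub>R) n"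
    unfolding composition_append sx sy using cx(1) cy(1) n by simp
  show "cut_set (cut_composition (xs @ ys) ?\<theta>) =
      cut_set (cut_composition xs \<theta>\<^sub>L @ cut_composition ys \<theta>\<^sub>R)"
    unfolding cut_composition_of_factorization_cuts(2)[OF \<alpha>] cut_set_append[OF ne'] cx(2) cy(2) sx
    by (rule factorization_cuts_append[OF assms])
qed

section \<open>Cutting a decorated ordered set partition\<close>

lemma diamond_list_Cons:
  "ws \<noteq> [] \<Longrightarrow> diamond_list (w # ws) = diamond (fst w) (snd w) (diamond_list ws)"
  by (cases w; cases ws) auto

lemma diamond_list_decorations:
  assumes "ws \<noteq> []" "\<forall>(b, \<xi>)\<in>set ws. \<xi> \<in> decorations b" "at_most_one_odd (map fst ws)"
  shows "diamond_list ws \<in> decorations (sum_list (map fst ws))"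
  using assms
proof (induct ws)
  case (Cons w ws)
  have w: "snd w \<in> decorations (fst w)" using Cons.prems(2) by auto
  show ?case
  proof (cases "ws = []")
    case True
    then show ?thesis using w by (cases w) simp
  next
    case False
    have one: "at_most_one_odd ([fst w] @ map fst ws)" using Cons.prems(3) by simp
    have "diamond_list ws \<in> decorations (sum_list (map fst ws))"
      using Cons.hyps[OF False] Cons.prems(2) at_most_one_odd_append(2)[OF one] by simp
    then show ?thesis
      using diamond_decorations[OF _ w] at_most_one_odd_append(3)[OF one]
      by (simp add: diamond_list_Cons[OF False])
  qed
qed simp

text \<open>Induction on the left list moves one factor at a time across by associativity; parity holds at
  each step because all sizes come from a list with at most one odd entry.\<close>

lemma diamond_list_append:
  assumes "us \<noteq> []" "vs \<noteq> []" "\<forall>(b, \<xi>)\<in>set (us @ vs). \<xi> \<in> decorations b"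
    and "at_most_one_odd (map fst (us @ vs))"
  shows "diamond_list (us @ vs) = diamond (sum_list (map fst us)) (diamond_list us) (diamond_list vs)"
  using assms
proof (induct us)
  case (Cons w us)
  have w: "snd w \<in> decorations (fst w)" using Cons.prems(3) by auto
  have vs: "diamond_list vs \<in> decorations (sum_list (map fst vs))"
    using diamond_list_decorations[OF Cons.prems(2)] Cons.prems(3)
      at_most_one_odd_append(2)[of "map fst (w # us)" "map fst vs"] Cons.prems(4) by auto
  show ?case
  proof (cases "us = []")
    case True
    then show ?thesis using Cons.prems(2) by (cases w) (simp add: diamond_list_Cons)
  next
    case False
    have one: "at_most_one_odd ([fst w] @ map fst us)" and one': "at_most_one_odd (map fst (us @ vs))"
      using at_most_one_odd_append(1)[of "map fst (w # us)" "map fst vs"]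
        at_most_one_odd_append(2)[of "[fst w]" "map fst (us @ vs)"] Cons.prems(4) by auto
    have us: "diamond_list us \<in> decorations (sum_list (map fst us))"
      using diamond_list_decorations[OF False] Cons.prems(3) at_most_one_odd_append(2)[OF one] by auto
    have "diamond_list ((w # us) @ vs) = diamond (fst w) (snd w)
        (diamond (sum_list (map fst us)) (diamond_list us) (diamond_list vs))"
      using Cons.hyps[OF False Cons.prems(2) _ one'] Cons.prems(3) False
      by (simp add: diamond_list_Cons)
    also have "\<dots> = diamond (fst w + sum_list (map fst us))
        (diamond (fst w) (snd w) (diamond_list us)) (diamond_list vs)"
      using diamond_assoc[OF _ w us vs] at_most_one_odd_append(3)[OF one] by simp
    finally show ?thesis using False by (simp add: diamond_list_Cons)
  qed
qed simp

lemma card_union_disjoint_blocks: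
  assumes "disjoint_family_on ((!) Bs) {..<length Bs}" "finite (\<Union>(set Bs))"
  shows "card (\<Union>(set Bs)) = sum_list (map card Bs)"
proof -
  have U: "\<Union>(set Bs) = (\<Union>i\<in>{..<length Bs}. Bs ! i)" by (auto simp: set_conv_nth)
  have "finite (Bs ! i)" if "i < length Bs" for i
    using assms(2) that by (meson Union_upper finite_subset nth_mem)
  hence "card (\<Union>i\<in>{..<length Bs}. Bs ! i) = (\<Sum>i<length Bs. card (Bs ! i))"
    using assms(1) by (intro card_UN_disjoint) (auto simp: disjoint_family_on_def)
  then show ?thesis unfolding U by (simp add: sum_list_sum_nth atLeast0LessThan)
qed

lemma coarsens_append:
  assumes xs: "composition xs c" "composition xs' c" and ne: "xs \<noteq> []" "xs' \<noteq> []" "ys \<noteq> []" "ys' \<noteq> []"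
    and ys: "composition ys m" "composition ys' m"
    and co: "coarsens (xs' @ ys') (xs @ ys)"
  shows "coarsens xs' xs" "coarsens ys' ys"
proof -
  have c: "sum_list xs = c" "sum_list xs' = c" using xs by (auto simp: composition_def)
  have sub: "cut_set xs' \<union> {c} \<union> (+) c ` cut_set ys' \<subseteq> cut_set xs \<union> {c} \<union> (+) c ` cut_set ys"
    using co unfolding coarsens_def cut_set_append[OF ne(1,3)] cut_set_append[OF ne(2,4)] c .
  show "coarsens xs' xs" unfolding coarsens_def
  proof
    fix d assume d: "d \<in> cut_set xs'"
    hence "d < c" using cut_set_bounds[OF xs(2)] by blast
    then show "d \<in> cut_set xs" using d sub by auto
  qed
  show "coarsens ys' ys" unfolding coarsens_def
  proof
    fix d assume d: "d \<in> cut_set ys'"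
    hence "0 < d" using cut_set_bounds[OF ys(2)] by blast
    moreover have "c + d \<in> cut_set xs \<union> {c} \<union> (+) c ` cut_set ys" using d sub by auto
    ultimately show "d \<in> cut_set ys" using cut_set_bounds(2)[OF xs(1), of "c + d"] by auto
  qed
qed

text \<open>The size of \<open>S\<close> is both the partial sum \<open>c\<^sub>p\<close> of \<open>\<alpha>\<close> and the sum of the first \<open>j\<close> block sizes,
  so \<open>\<alpha>\<close> and the coarser composition of block sizes are split at the same cut. Each piece is
  therefore a cell of the corresponding part of \<open>\<alpha>\<close>, and the total decoration splits by
  associativity.\<close>

lemma cut_cell_pieces:
  assumes \<alpha>: "composition \<alpha> n" and one: "at_most_one_odd \<alpha>" and I: "finite I"
    and p: "1 \<le> p" "p < length \<alpha>" and ST: "S \<union> T = I" "S \<inter> T = {}" "card S = psum \<alpha> p"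
    and w: "(Bs, \<xi>s) \<in> cells \<alpha> I k" and j: "j \<le> length Bs" "S = \<Union>(set (take j Bs))"
  defines "L \<equiv> (take j Bs, take j \<xi>s)" and "R \<equiv> (drop j Bs, drop j \<xi>s)"
  shows "L \<in> cells (take p \<alpha>) S j" "R \<in> cells (drop p \<alpha>) T (k - j)"
    and "total_decoration L \<in> decorations (psum \<alpha> p)"
    and "total_decoration R \<in> decorations (n - psum \<alpha> p)"
    and "total_decoration (Bs, \<xi>s) = diamond (psum \<alpha> p) (total_decoration L) (total_decoration R)"
    and "psum (map card Bs) j = psum \<alpha> p"
    and "composition (map card Bs) n"
proof -
  define c where "c = psum \<alpha> p"
  have n: "sum_list \<alpha> = n" using \<alpha> by (simp add: composition_def)
  define \<beta> where "\<beta> = map card Bs"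
  have \<beta>: "composition \<beta> n" "coarsens \<beta> \<alpha>" "length \<beta> = k" "\<Union>(set Bs) = I"
      and dis: "disjoint_family_on ((!) Bs) {..<length Bs}"
      and k: "length Bs = k" "length \<xi>s = k" and \<xi>: "\<And>i. i < k \<Longrightarrow> \<xi>s ! i \<in> decorations (\<beta> ! i)"
    using w unfolding cells_def ordered_set_partitions_def n \<beta>_def by auto
  have disL: "disjoint_family_on ((!) (take j Bs)) {..<length (take j Bs)}"
    using dis by (auto simp: disjoint_family_on_def)
  have disR: "disjoint_family_on ((!) (drop j Bs)) {..<length (drop j Bs)}"
    using dis unfolding disjoint_family_on_def by simp
  have un: "\<Union>(set (take j Bs)) \<union> \<Union>(set (drop j Bs)) = I"
    using \<beta>(4) by (metis Union_Un_distrib append_take_drop_id set_append)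
  have "\<Union>(set (take j Bs)) \<inter> \<Union>(set (drop j Bs)) = {}"
  proof (rule ccontr)
    assume "\<not> ?thesis"
    then obtain x A B where x: "x \<in> A" "x \<in> B" "A \<in> set (take j Bs)" "B \<in> set (drop j Bs)" by blast
    obtain i where i: "i < j" "A = Bs ! i" using x(3) by (auto simp: in_set_conv_nth)
    obtain i' where i': "j + i' < length Bs" "B = Bs ! (j + i')"
      using x(4) j(1) by (metis in_set_conv_nth length_drop less_diff_conv add.commute nth_drop)
    have "Bs ! i \<inter> Bs ! (j + i') = {}"
      using dis i(1) i'(1) j(1) unfolding disjoint_family_on_def by simp
    then show False using x(1,2) i(2) i'(2) by blast
  qed
  hence T: "\<Union>(set (drop j Bs)) = T" using un ST(1,2) j(2) by blast
  have fS: "finite S" using I ST(1) by (metis finite_Un)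
  have sumL: "sum_list (take j \<beta>) = c"
    using card_union_disjoint_blocks[OF disL] fS ST(3) j(2) by (simp add: \<beta>_def c_def take_map)
  then show psum: "psum (map card Bs) j = psum \<alpha> p" by (simp add: psum_def \<beta>_def c_def)
  show "composition (map card Bs) n" using \<beta>(1) by (simp add: \<beta>_def)
  have "composition (take p \<alpha> @ drop p \<alpha>) n" "composition (take j \<beta> @ drop j \<beta>) n"
    using \<alpha> \<beta>(1) by simp_all
  note comp = this[unfolded composition_append]
  have ca: "sum_list (take p \<alpha>) = c" by (simp add: c_def psum_def)
  have cpos: "0 < c" "c < n"
    using psum_less[OF \<alpha>, of 0 p] psum_less[OF \<alpha>, of p "length \<alpha>"] p
    by (auto simp: c_def psum_def n)
  have sums: "sum_list (drop p \<alpha>) = n - c" "sum_list (drop j \<beta>) = n - c"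
    using comp ca sumL by auto
  have CL: "composition (take p \<alpha>) c" "composition (take j \<beta>) c"
    and CR: "composition (drop p \<alpha>) (n - c)" "composition (drop j \<beta>) (n - c)"
    using comp ca sumL sums by simp_all
  have ne: "take p \<alpha> \<noteq> []" "take j \<beta> \<noteq> []" "drop p \<alpha> \<noteq> []" "drop j \<beta> \<noteq> []"
    using CL[THEN composition_pos] CR[THEN composition_pos] cpos by simp_all
  have co: "coarsens (take j \<beta>) (take p \<alpha>)" "coarsens (drop j \<beta>) (drop p \<alpha>)"
    using coarsens_append[OF CL ne CR] \<beta>(2) by simp_all
  have jk: "j \<le> k" using j(1) k by simp
  show "L \<in> cells (take p \<alpha>) S j"
    unfolding cells_def L_def ca
    using CL(2) co(1) disL j(2) jk k \<xi> \<beta>(3)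
    by (auto simp: ordered_set_partitions_def \<beta>_def take_map intro!: exI[of _ "take j \<beta>"])
  show "R \<in> cells (drop p \<alpha>) T (k - j)"
    unfolding cells_def R_def sums
    using CR(2) co(2) disR T jk k \<xi> \<beta>(3)
    by (auto simp: ordered_set_partitions_def \<beta>_def drop_map intro!: exI[of _ "drop j \<beta>"])
  define us vs where "us = zip (take j \<beta>) (take j \<xi>s)" and "vs = zip (drop j \<beta>) (drop j \<xi>s)"
  have zip: "zip \<beta> \<xi>s = us @ vs"
    unfolding us_def vs_def by (metis append_take_drop_id take_zip drop_zip)
  have fst: "map fst us = take j \<beta>" "map fst vs = drop j \<beta>"
    using k \<beta>(3) by (auto simp: us_def vs_def)
  have ne': "us \<noteq> []" "vs \<noteq> []" using fst ne by auto
  have dec: "\<forall>(b, \<xi>)\<in>set (us @ vs). \<xi> \<in> decorations b"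
    unfolding zip[symmetric] using \<xi> k \<beta>(3) by (auto simp: set_zip)
  have "at_most_one_odd \<beta>" using at_most_one_odd_coarsens[OF one \<alpha> \<beta>(1,2)] .
  hence odd: "at_most_one_odd (map fst (us @ vs))" using fst by simp
  have tot: "total_decoration L = diamond_list us" "total_decoration R = diamond_list vs"
      "total_decoration (Bs, \<xi>s) = diamond_list (us @ vs)"
    unfolding zip[symmetric]
    by (simp_all add: total_decoration_def L_def R_def us_def vs_def \<beta>_def take_map drop_map)
  show "total_decoration L \<in> decorations (psum \<alpha> p)"
    using diamond_list_decorations[OF ne'(1)] dec odd at_most_one_odd_append(1)[of "map fst us" "map fst vs"]
    unfolding tot fst sumL by (simp add: c_def fst sumL[unfolded c_def])
  show "total_decoration R \<in> decorations (n - psum \<alpha> p)"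
    using diamond_list_decorations[OF ne'(2)] dec odd at_most_one_odd_append(2)[of "map fst us" "map fst vs"]
    unfolding tot by (simp add: fst sums c_def[symmetric])
  show "total_decoration (Bs, \<xi>s) = diamond (psum \<alpha> p) (total_decoration L) (total_decoration R)"
    using diamond_list_append[OF ne' dec odd] unfolding tot by (simp add: fst sumL c_def[symmetric])
qed

section \<open>The coproduct on total-decoration components\<close>

lemma keys_basis_span:
  assumes "f \<in> basis_span X"
  shows "Poly_Mapping.keys f \<subseteq> X"
  using assms unfolding basis_span_def
proof (induct rule: free_vs.span_induct_alt)
  case base
  then show ?case by simp
next
  case (step c x y)
  have "Poly_Mapping.keys (scale c x) \<subseteq> X"
    using step(1) by (auto simp: in_keys_iff lookup_single when_def split: if_splits)
  then show ?case using step(2) Poly_Mapping.keys_add[of "scale c x" y] by blast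
qed

lemma linear_extension_in_span:
  assumes "f \<in> basis_span X" "\<And>b. b \<in> X \<Longrightarrow> g b \<in> free_vs.span Y"
  shows "linear_extension g f \<in> free_vs.span Y"
  unfolding linear_extension_def
  using keys_basis_span[OF assms(1)] assms(2)
  by (intro free_vs.span_sum free_vs.span_scale) auto

lemma linear_extension_zero:
  assumes "f \<in> basis_span X" "\<And>b. b \<in> X \<Longrightarrow> g b = 0"
  shows "linear_extension g f = 0"
  unfolding linear_extension_def
  using keys_basis_span[OF assms(1)] assms(2) by (intro sum.neutral) auto

lemma single_in_basis_span: "b \<in> X \<Longrightarrow> Poly_Mapping.single b 1 \<in> basis_span X"
  unfolding basis_span_def by (intro free_vs.span_base imageI)

text \<open>Phrased with a predicate on the value, so that the coefficient field is fixed by the goal to which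
  the rule is applied. Blocks are nonempty, hence at most one \<open>j\<close> gives the set \<open>S\<close> and the definite
  description in \<open>cut_cell\<close> denotes it.\<close>

lemma cut_cell_cases:
  assumes "composition \<alpha> n" "at_most_one_odd \<alpha>" "finite I"
    and "1 \<le> p" "p < length \<alpha>" "S \<union> T = I" "S \<inter> T = {}" "card S = psum \<alpha> p"
    and w: "w \<in> cells \<alpha> I k" and zero: "P 0"
    and pieces: "\<And>L R i j. L \<in> cells (take p \<alpha>) S i \<Longrightarrow> R \<in> cells (drop p \<alpha>) T j \<Longrightarrow>
      total_decoration L \<in> decorations (psum \<alpha> p) \<Longrightarrow>
      total_decoration R \<in> decorations (n - psum \<alpha> p) \<Longrightarrow>
      total_decoration w = diamond (psum \<alpha> p) (total_decoration L) (total_decoration R) \<Longrightarrow>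
      P (tensor (Poly_Mapping.single L 1) (Poly_Mapping.single R 1))"
  shows "P (cut_cell S w)"
proof -
  obtain Bs \<xi>s where w': "w = (Bs, \<xi>s)" by (cases w)
  show ?thesis
  proof (cases "\<exists>j\<le>length Bs. S = \<Union>(set (take j Bs))")
    case False
    show ?thesis
      unfolding cut_cell_def w' Let_def fst_conv snd_conv if_not_P[OF False] by (rule zero)
  next
    case True
    then obtain j where j: "j \<le> length Bs" "S = \<Union>(set (take j Bs))" by blast
    note P = cut_cell_pieces[OF assms(1-8) w[unfolded w']]
    have "i = j" if "i \<le> length Bs \<and> S = \<Union>(set (take i Bs))" for i
    proof -
      have "psum (map card Bs) i = psum (map card Bs) j"
        using P(6)[of i] P(6)[OF j] that by simp
      then show ?thesis
        using psum_mono_iff[OF P(7)[OF j], of i j] psum_mono_iff[OF P(7)[OF j], of j i] that j by simp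
    qed
    hence the: "(THE j. j \<le> length Bs \<and> S = \<Union>(set (take j Bs))) = j"
      using j by (intro the_equality) auto
    show ?thesis
      unfolding cut_cell_def w' Let_def fst_conv snd_conv if_P[OF True] the
      by (rule pieces) (use P(1-5)[OF j] w' in auto)
  qed
qed

text \<open>On a cell the two pieces have total decorations whose product is \<open>\<theta>\<close>; by uniqueness of the
  factorization these are the given factors.\<close>

lemma cut_coproduct_in_tensor_space:
  assumes hyp: "composition \<alpha> n" "at_most_one_odd \<alpha>" "finite I"
    "1 \<le> p" "p < length \<alpha>" "S \<union> T = I" "S \<inter> T = {}" "card S = psum \<alpha> p"
    and LR: "is_factorization n (psum \<alpha> p) \<theta> (\<theta>\<^sub>L, \<theta>\<^sub>R)"
    and f: "f \<in> chains_dec \<alpha> \<theta> I"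
  shows "cut_coproduct S f \<in>
    tensor_space (chains_dec (take p \<alpha>) \<theta>\<^sub>L S) (chains_dec (drop p \<alpha>) \<theta>\<^sub>R T)"
  unfolding cut_coproduct_def tensor_space_def
proof (rule linear_extension_in_span[OF f[unfolded chains_dec_def]])
  let ?V = "free_vs.span {tensor u v |u v. u \<in> chains_dec (take p \<alpha>) \<theta>\<^sub>L S \<and> v \<in> chains_dec (drop p \<alpha>) \<theta>\<^sub>R T}"
  fix w assume w: "w \<in> {w \<in> \<Union>k. cells \<alpha> I k. total_decoration w = \<theta>}"
  then obtain k where "w \<in> cells \<alpha> I k" and tot: "total_decoration w = \<theta>" by blast
  show "cut_cell S w \<in> ?V"
  proof (rule cut_cell_cases[OF hyp \<open>w \<in> cells \<alpha> I k\<close>, where P = "\<lambda>v. v \<in> ?V"])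
    show "0 \<in> ?V" by (rule free_vs.span_zero)
  next
    fix L R :: "'a cell" and i j
    assume L: "L \<in> cells (take p \<alpha>) S i" "total_decoration L \<in> decorations (psum \<alpha> p)"
      and R: "R \<in> cells (drop p \<alpha>) T j" "total_decoration R \<in> decorations (n - psum \<alpha> p)"
      and w: "total_decoration w = diamond (psum \<alpha> p) (total_decoration L) (total_decoration R)"
    have "\<theta>\<^sub>L \<in> decorations (psum \<alpha> p)" "\<theta>\<^sub>R \<in> decorations (n - psum \<alpha> p)"
      and "diamond (psum \<alpha> p) (total_decoration L) (total_decoration R) = diamond (psum \<alpha> p) \<theta>\<^sub>L \<theta>\<^sub>R"
      using LR w tot by (auto simp: is_factorization_def)
    from diamond_inject[OF L(2) this(1) R(2) this(2,3)]
    have "Poly_Mapping.single L 1 \<in> chains_dec (take p \<alpha>) \<theta>\<^sub>L S"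
        "Poly_Mapping.single R 1 \<in> chains_dec (drop p \<alpha>) \<theta>\<^sub>R T"
      unfolding chains_dec_def using L(1) R(1) by (auto intro!: single_in_basis_span)
    then show "tensor (Poly_Mapping.single L 1) (Poly_Mapping.single R 1) \<in> ?V"
      by (intro free_vs.span_base) blast
  qed
qed

lemma psum_complement_parity:
  assumes "composition \<alpha> n" "at_most_one_odd \<alpha>"
  shows "psum \<alpha> p \<le> n" "\<not> (odd (psum \<alpha> p) \<and> odd (n - psum \<alpha> p))"
proof -
  have "sum_list (take p \<alpha>) + sum_list (drop p \<alpha>) = n"
    using assms(1) by (metis append_take_drop_id composition_def sum_list_append)
  then show "psum \<alpha> p \<le> n" "\<not> (odd (psum \<alpha> p) \<and> odd (n - psum \<alpha> p))"
    using at_most_one_odd_append(3)[of "take p \<alpha>" "drop p \<alpha>"] assms(2)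
    unfolding psum_def by auto
qed

text \<open>A nonzero value on some cell would exhibit \<open>\<theta>\<close> as a product of decorations of sizes \<open>c\<^sub>p\<close> and
  \<open>n - c\<^sub>p\<close>, making \<open>c\<^sub>p\<close> a factorization cut.\<close>

lemma cut_coproduct_eq_0:
  assumes hyp: "composition \<alpha> n" "at_most_one_odd \<alpha>" "finite I"
    "1 \<le> p" "p < length \<alpha>" "S \<union> T = I" "S \<inter> T = {}" "card S = psum \<alpha> p"
    and cut: "psum \<alpha> p \<notin> factorization_cuts \<alpha> \<theta>"
    and f: "f \<in> chains_dec \<alpha> \<theta> I"
  shows "cut_coproduct S f = 0"
  unfolding cut_coproduct_def
proof (rule linear_extension_zero[OF f[unfolded chains_dec_def]])
  fix w assume w: "w \<in> {w \<in> \<Union>k. cells \<alpha> I k. total_decoration w = \<theta>}"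
  then obtain k where "w \<in> cells \<alpha> I k" and tot: "total_decoration w = \<theta>" by blast
  show "cut_cell S w = 0"
  proof (rule cut_cell_cases[OF hyp \<open>w \<in> cells \<alpha> I k\<close>, where P = "\<lambda>v. v = 0"])
    fix L R :: "'a cell"
    assume L: "total_decoration L \<in> decorations (psum \<alpha> p)"
      and R: "total_decoration R \<in> decorations (n - psum \<alpha> p)"
      and w: "total_decoration w = diamond (psum \<alpha> p) (total_decoration L) (total_decoration R)"
    note par = psum_complement_parity[OF hyp(1,2), of p]
    have "factorization_cut n \<theta> (psum \<alpha> p)"
      using factorization_cut_diamond(1)[OF par(2) L R order_refl]
        factorization_cut_full[OF L] par(1) w tot by simp
    moreover have "psum \<alpha> p \<in> cut_set \<alpha>" using hyp(4,5) by (auto simp: cut_set_def)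
    ultimately show "tensor (Poly_Mapping.single L 1) (Poly_Mapping.single R 1) = 0"
      using cut hyp(1) by (simp add: factorization_cuts_def composition_def)
  qed simp
qed

lemma factorization_splits_cuts:
  assumes \<alpha>: "composition \<alpha> n" and one: "at_most_one_odd \<alpha>" and p: "1 \<le> p" "p < length \<alpha>"
    and LR: "is_factorization n (psum \<alpha> p) \<theta> (\<theta>\<^sub>L, \<theta>\<^sub>R)"
  shows "factorization_cuts \<alpha> \<theta> = factorization_cuts (take p \<alpha>) \<theta>\<^sub>L \<union> {psum \<alpha> p} \<union>
      (+) (psum \<alpha> p) ` factorization_cuts (drop p \<alpha>) \<theta>\<^sub>R"
    and "cut_composition \<alpha> \<theta> =
      cut_composition (take p \<alpha>) \<theta>\<^sub>L @ cut_composition (drop p \<alpha>) \<theta>\<^sub>R"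
    and "d \<in> factorization_cuts (take p \<alpha>) \<theta>\<^sub>L \<Longrightarrow> d < psum \<alpha> p"
    and "d \<in> factorization_cuts (drop p \<alpha>) \<theta>\<^sub>R \<Longrightarrow> 0 < d"
proof -
  have ne: "take p \<alpha> \<noteq> []" "drop p \<alpha> \<noteq> []" using p by auto
  have \<alpha>': "composition (take p \<alpha> @ drop p \<alpha>) n" and one': "at_most_one_odd (take p \<alpha> @ drop p \<alpha>)"
    using \<alpha> one by simp_all
  have sums: "sum_list (take p \<alpha>) = psum \<alpha> p" "sum_list (drop p \<alpha>) = n - psum \<alpha> p"
    using \<alpha>'[unfolded composition_append] by (auto simp: psum_def)
  have L: "\<theta>\<^sub>L \<in> decorations (sum_list (take p \<alpha>))" and R: "\<theta>\<^sub>R \<in> decorations (sum_list (drop p \<alpha>))"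
    and \<theta>: "\<theta> = diamond (psum \<alpha> p) \<theta>\<^sub>L \<theta>\<^sub>R"
    using LR unfolding sums by (auto simp: is_factorization_def)
  show "factorization_cuts \<alpha> \<theta> = factorization_cuts (take p \<alpha>) \<theta>\<^sub>L \<union> {psum \<alpha> p} \<union>
      (+) (psum \<alpha> p) ` factorization_cuts (drop p \<alpha>) \<theta>\<^sub>R"
    using factorization_cuts_append[OF \<alpha>' one' ne L R] unfolding sums(1) append_take_drop_id \<theta> .
  show "cut_composition \<alpha> \<theta> =
      cut_composition (take p \<alpha>) \<theta>\<^sub>L @ cut_composition (drop p \<alpha>) \<theta>\<^sub>R"
    using cut_composition_append[OF \<alpha>' one' ne L R] unfolding sums(1) append_take_drop_id \<theta> .
  have C: "composition (take p \<alpha>) (psum \<alpha> p)" "composition (drop p \<alpha>) (n - psum \<alpha> p)"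
    using \<alpha>'[unfolded composition_append] unfolding sums by auto
  show "d \<in> factorization_cuts (take p \<alpha>) \<theta>\<^sub>L \<Longrightarrow> d < psum \<alpha> p"
    using cut_set_bounds(2)[OF C(1)] by (auto simp: factorization_cuts_def)
  show "d \<in> factorization_cuts (drop p \<alpha>) \<theta>\<^sub>R \<Longrightarrow> 0 < d"
    using cut_set_bounds(1)[OF C(2)] by (auto simp: factorization_cuts_def)
qed

lemma finite_splits: "finite I \<Longrightarrow> finite (splits \<alpha> I)"
  by (rule finite_subset[of _ "{..<length \<alpha>} \<times> Pow I \<times> Pow I"]) (auto simp: splits_def)

theorem theorem3p14:
  fixes \<alpha> :: "nat list" and n :: nat and I :: "'a set" and \<theta> :: decoration
  assumes "1 \<le> n" and "composition \<alpha> n" and "at_most_one_odd \<alpha>"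
    and "finite I" and "card I = n" and "\<theta> \<in> decorations n"
  shows
    "(\<forall>p c S T. 1 \<le> p \<and> p < length \<alpha> \<and> c = psum \<alpha> p \<and> S \<union> T = I \<and> S \<inter> T = {} \<and> card S = c \<longrightarrow>
       (c \<notin> factorization_cuts \<alpha> \<theta> \<longrightarrow>
          cut_coproduct S ` (chains_dec \<alpha> \<theta> I :: ('a cell \<Rightarrow>\<^sub>0 'k::field_char_0) set) = {0}) \<and>
       (c \<in> factorization_cuts \<alpha> \<theta> \<longrightarrow>
          (\<exists>!\<theta>s. is_factorization n c \<theta> \<theta>s) \<and>
          (\<forall>\<theta>\<^sub>L \<theta>\<^sub>R. is_factorization n c \<theta> (\<theta>\<^sub>L, \<theta>\<^sub>R) \<longrightarrow>
             cut_coproduct S ` (chains_dec \<alpha> \<theta> I :: ('a cell \<Rightarrow>\<^sub>0 'k) set)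
               \<subseteq> tensor_space (chains_dec (take p \<alpha>) \<theta>\<^sub>L S) (chains_dec (drop p \<alpha>) \<theta>\<^sub>R T) \<and>
             factorization_cuts \<alpha> \<theta> =
               factorization_cuts (take p \<alpha>) \<theta>\<^sub>L \<union> {c} \<union> (+) c ` factorization_cuts (drop p \<alpha>) \<theta>\<^sub>R \<and>
             c \<notin> factorization_cuts (take p \<alpha>) \<theta>\<^sub>L \<and>
             c \<notin> (+) c ` factorization_cuts (drop p \<alpha>) \<theta>\<^sub>R \<and>
             factorization_cuts (take p \<alpha>) \<theta>\<^sub>L \<inter> (+) c ` factorization_cuts (drop p \<alpha>) \<theta>\<^sub>R = {} \<and>
             cut_composition \<alpha> \<theta> =
               cut_composition (take p \<alpha>) \<theta>\<^sub>L @ cut_composition (drop p \<alpha>) \<theta>\<^sub>R)))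
     \<and> reduced_cut_coproduct \<alpha> I ` (chains_dec \<alpha> \<theta> I :: ('a cell \<Rightarrow>\<^sub>0 'k) set)
         \<subseteq> direct_sum {(p, S, T) \<in> splits \<alpha> I. psum \<alpha> p \<in> factorization_cuts \<alpha> \<theta>}
             (\<lambda>(p, S, T). tensor_space
                (chains_dec (take p \<alpha>) (left_factor n (psum \<alpha> p) \<theta>) S)
                (chains_dec (drop p \<alpha>) (right_factor n (psum \<alpha> p) \<theta>) T))"
    (is "?local \<and> ?reduced")
proof
  note \<alpha> = assms(2) and one = assms(3) and fin = assms(4) and \<theta> = assms(6)
  have n: "sum_list \<alpha> = n" using \<alpha> by (simp add: composition_def)
  have ex1: "\<exists>!\<theta>s. is_factorization n (psum \<alpha> p) \<theta> \<theta>s"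
    if "psum \<alpha> p \<in> factorization_cuts \<alpha> \<theta>" for p
    using is_factorization_ex1[OF psum_complement_parity[OF \<alpha> one] \<theta>] that
    by (simp add: factorization_cuts_def n)
  show ?local
  proof (intro allI impI, elim conjE, intro conjI impI allI, goal_cases)
    case (1 p c S T)
    have zero: "(0 :: 'a cell \<Rightarrow>\<^sub>0 'k) \<in> chains_dec \<alpha> \<theta> I"
      unfolding chains_dec_def basis_span_def by (rule free_vs.span_zero)
    have all: "cut_coproduct S f = 0" if "f \<in> chains_dec \<alpha> \<theta> I" for f :: "'a cell \<Rightarrow>\<^sub>0 'k"
      by (rule cut_coproduct_eq_0[OF \<alpha> one fin, of p S T \<theta>]) (use 1 that in auto)
    show ?case using all zero by (auto simp: image_iff)
  next
    case (2 p c S T)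
    then show ?case using ex1 by simp
  next
    case (3 p c S T \<theta>\<^sub>L \<theta>\<^sub>R)
    then show ?case
      using cut_coproduct_in_tensor_space[OF \<alpha> one fin, of p S T \<theta> \<theta>\<^sub>L \<theta>\<^sub>R] by blast
  next
    case (4 p c S T \<theta>\<^sub>L \<theta>\<^sub>R)
    then show ?case using factorization_splits_cuts(1)[OF \<alpha> one, of p] by simp
  next
    case (5 p c S T \<theta>\<^sub>L \<theta>\<^sub>R)
    then show ?case using factorization_splits_cuts(3)[OF \<alpha> one, of p] by blast
  next
    case (6 p c S T \<theta>\<^sub>L \<theta>\<^sub>R)
    hence "0 < d" if "d \<in> factorization_cuts (drop p \<alpha>) \<theta>\<^sub>R" for d
      using factorization_splits_cuts(4)[OF \<alpha> one, of p \<theta> \<theta>\<^sub>L \<theta>\<^sub>R d] that by blast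
    then show ?case by (auto simp: image_iff)
  next
    case (7 p c S T \<theta>\<^sub>L \<theta>\<^sub>R)
    hence "d < c" if "d \<in> factorization_cuts (take p \<alpha>) \<theta>\<^sub>L" for d
      using factorization_splits_cuts(3)[OF \<alpha> one, of p \<theta> \<theta>\<^sub>L \<theta>\<^sub>R d] that by blast
    then show ?case by fastforce
  next
    case (8 p c S T \<theta>\<^sub>L \<theta>\<^sub>R)
    then show ?case using factorization_splits_cuts(2)[OF \<alpha> one, of p] by simp
  qed
  have factors: "is_factorization n (psum \<alpha> p) \<theta>
      (left_factor n (psum \<alpha> p) \<theta>, right_factor n (psum \<alpha> p) \<theta>)"
    if "psum \<alpha> p \<in> factorization_cuts \<alpha> \<theta>" for p
    using theI'[OF ex1[OF that]] by (simp add: left_factor_def right_factor_def)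
  let ?J = "{(p, S, T) \<in> splits \<alpha> I. psum \<alpha> p \<in> factorization_cuts \<alpha> \<theta>}"
  show ?reduced
  proof (rule image_subsetI)
    fix f :: "'a cell \<Rightarrow>\<^sub>0 'k" assume f: "f \<in> chains_dec \<alpha> \<theta> I"
    let ?g = "reduced_cut_coproduct \<alpha> I f"
    have off: "?g j = 0" if "j \<notin> ?J" for j
    proof -
      obtain p S T where j: "j = (p, S, T)" by (cases j)
      show ?thesis
      proof (cases "j \<in> splits \<alpha> I")
        case True
        hence "cut_coproduct S f = 0"
          using that cut_coproduct_eq_0[OF \<alpha> one fin, of p S T \<theta> f] f unfolding j splits_def by simp
        then show ?thesis by (simp add: j reduced_cut_coproduct_def)
      next
        case False
        then show ?thesis by (simp add: j reduced_cut_coproduct_def)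
      qed
    qed
    have on: "?g (p, S, T) \<in> tensor_space
        (chains_dec (take p \<alpha>) (left_factor n (psum \<alpha> p) \<theta>) S)
        (chains_dec (drop p \<alpha>) (right_factor n (psum \<alpha> p) \<theta>) T)"
      if "(p, S, T) \<in> ?J" for p S T
    proof -
      have pST: "(p, S, T) \<in> splits \<alpha> I" and cut: "psum \<alpha> p \<in> factorization_cuts \<alpha> \<theta>"
        using that by auto
      have "cut_coproduct S f \<in> tensor_space
          (chains_dec (take p \<alpha>) (left_factor n (psum \<alpha> p) \<theta>) S)
          (chains_dec (drop p \<alpha>) (right_factor n (psum \<alpha> p) \<theta>) T)"
        by (rule cut_coproduct_in_tensor_space[OF \<alpha> one fin _ _ _ _ _ factors[OF cut] f])
          (use pST in \<open>auto simp: splits_def\<close>)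
      then show ?thesis using pST by (simp add: reduced_cut_coproduct_def)
    qed
    have "{j. ?g j \<noteq> 0} \<subseteq> splits \<alpha> I"
      by (auto simp: reduced_cut_coproduct_def split: if_splits)
    hence "finite {j. ?g j \<noteq> 0}" using finite_splits[OF fin] finite_subset by blast
    then show "?g \<in> direct_sum ?J (\<lambda>(p, S, T). tensor_space
        (chains_dec (take p \<alpha>) (left_factor n (psum \<alpha> p) \<theta>) S)
        (chains_dec (drop p \<alpha>) (right_factor n (psum \<alpha> p) \<theta>) T))"
      using on off unfolding direct_sum_def by blast
  qed
qed

end
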